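(* Let $\ell>0$ and let $f\in W^{1,2}(0,\ell)$ be complex-valued with $f(x)\neq0$ for all $x\in[0,\ell]$ and $f(0)=1$. Let $\mathbf{T}_f$ and $\mathbf{T}_{\frac1f}$ be the transmutation operators associated with $f$ and $\frac1f$. Then $\mathbf{T}_f(W^{1,2}(-\ell,\ell))\subset W^{1,2}(0,\ell)$ and $$\mathbf{D}_f\mathbf{T}_fy=\mathbf{T}_{\frac1f}y'\qquad\forall y\in W^{1,2}(-\ell,\ell).$$
   Context: All functions are complex-valued. $\mathcal{T}_\ell=\{(x,t): 0\le x\le\ell,\ |t|\le x\}$. $\mathbf{D}_f y:=f(y/f)'=y'-\frac{f'}{f}y$, $\mathbf{D}_{\frac1f}y:=\frac1f(fy)'=y'+\frac{f'}{f}y$. $\mathbf{S}_f$ is the Schrödinger operator $-y''+q_fy$ on $(0,\ell)$ with distributional potential $q_f=f''/f\in W^{-1,2}(0,\ell)$; its domain is $\mathscr{D}_2(\mathbf{S}_f)=\{y\in W^{1,2}(0,\ell):\mathbf{D}_fy\in W^{1,2}(0,\ell)\}$ and there $\mathbf{S}_fy=-\mathbf{D}_{\frac1f}\mathbf{D}_fy\in L^2(0,\ell)$. For $\rho\in\mathbb{C}$, $e_f(\rho,\cdot)\in\mathscr{D}_2(\mathbf{S}_f)$ is the unique solution of $\mathbf{S}_fy=\rho^2y$ with $y(0)=1$, $\mathbf{D}_fy(0)=i\rho$. $K_f\in L^2(\mathcal{T}_\ell)$ is the kernel with $K_f(x,\cdot)\in L^2(-x,x)$ and $e_f(\rho,x)=e^{i\rho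 x}+\int_{-x}^xK_f(x,t)e^{i\rho t}dt$ for all $\rho\in\mathbb{C}$, $x\in(0,\ell]$ (such a kernel exists and is unique up to null sets). The operator $\mathbf{T}_f:L^2(-\ell,\ell)\to L^2(0,\ell)$ is $\mathbf{T}_fy(x)=y(x)+\int_{-x}^xK_f(x,t)y(t)\,dt$. Since $\frac1f$ satisfies the same assumptions as $f$, $\mathbf{S}_{\frac1f}=-\mathbf{D}_f\mathbf{D}_{\frac1f}$, $K_{\frac1f}$ and $\mathbf{T}_{\frac1f}$ are defined by replacing $f$ by $\frac1f$. *)

theory Defs
  imports "HOL-Analysis.Analysis"
begin

text \<open>Elements of function spaces are represented by actual functions; equality in the spaces is
  equality almost everywhere.\<close>

definition L2 :: "'a::euclidean_space set \<Rightarrow> ('a \<Rightarrow> complex) set" where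
  "L2 A = {y \<in> borel_measurable (lebesgue_on A).
             integrable (lebesgue_on A) (\<lambda>x. (cmod (y x))\<^sup>2)}"

definition test_functions :: "real \<Rightarrow> real \<Rightarrow> (real \<Rightarrow> real) set" where
  "test_functions a b =
     {\<phi>. (\<forall>n x. (deriv ^^ n) \<phi> differentiable (at x)) \<and> closure {x. \<phi> x \<noteq> 0} \<subseteq> {a<..<b}}"

definition is_weak_deriv :: "real \<Rightarrow> real \<Rightarrow> (real \<Rightarrow> complex) \<Rightarrow> (real \<Rightarrow> complex) \<Rightarrow> bool" where
  "is_weak_deriv a b y g \<longleftrightarrow>
     (\<forall>\<phi> \<in> test_functions a b.
        (LINT x|lebesgue_on {a<..<b}. y x * complex_of_real (deriv \<phi> x)) =
        - (LINT x|lebesgue_on {a<..<b}. g x * complex_of_real (\<phi> x)))"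

definition W12 :: "real \<Rightarrow> real \<Rightarrow> (real \<Rightarrow> complex) set" where
  "W12 a b = {y \<in> L2 {a<..<b}. \<exists>g \<in> L2 {a<..<b}. is_weak_deriv a b y g}"

text \<open>The weak derivative is determined up to null sets; for \<open>y \<in> W12 a b\<close> this picks a
  representative.\<close>

definition weak_deriv :: "real \<Rightarrow> real \<Rightarrow> (real \<Rightarrow> complex) \<Rightarrow> real \<Rightarrow> complex" where
  "weak_deriv a b y = (SOME g. g \<in> L2 {a<..<b} \<and> is_weak_deriv a b y g)"

text \<open>Point values of a Sobolev function, including those at the end points, are the values of its
  continuous representative, which is unique on \<open>{a..b}\<close>.\<close>

definition cont_rep :: "real \<Rightarrow> real \<Rightarrow> (real \<Rightarrow> complex) \<Rightarrow> real \<Rightarrow> complex" where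
  "cont_rep a b y =
     (SOME w. continuous_on {a..b} w \<and> (AE x in lebesgue_on {a<..<b}. w x = y x))"

text \<open>\<open>Dop l f y = f (y / f)'\<close> on the interval from \<open>0\<close> to \<open>l\<close>. The operator with \<open>f\<close> replaced by
  \<open>1 / f\<close> is \<open>(f y)' / f\<close>.\<close>

definition Dop :: "real \<Rightarrow> (real \<Rightarrow> complex) \<Rightarrow> (real \<Rightarrow> complex) \<Rightarrow> real \<Rightarrow> complex" where
  "Dop l f y = (\<lambda>x. f x * weak_deriv 0 l (\<lambda>s. y s / f s) x)"

definition schroedinger_dom :: "real \<Rightarrow> (real \<Rightarrow> complex) \<Rightarrow> (real \<Rightarrow> complex) set" where
  "schroedinger_dom l f = {y \<in> W12 0 l. Dop l f y \<in> W12 0 l}"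

text \<open>The operator \<open>- y'' + (f'' / f) y\<close> on \<open>schroedinger_dom l f\<close>, through its factorization.\<close>

definition schroedinger :: "real \<Rightarrow> (real \<Rightarrow> complex) \<Rightarrow> (real \<Rightarrow> complex) \<Rightarrow> real \<Rightarrow> complex" where
  "schroedinger l f y = (\<lambda>x. - Dop l (\<lambda>s. 1 / f s) (Dop l f y) x)"

definition is_e_solution ::
  "real \<Rightarrow> (real \<Rightarrow> complex) \<Rightarrow> complex \<Rightarrow> (real \<Rightarrow> complex) \<Rightarrow> bool" where
  "is_e_solution l f \<rho> e \<longleftrightarrow>
     e \<in> schroedinger_dom l f \<and> continuous_on {0..l} e \<and>
     (AE x in lebesgue_on {0<..<l}. schroedinger l f e x = \<rho>\<^sup>2 * e x) \<and>
     e 0 = 1 \<and> cont_rep 0 l (Dop l f e) 0 = \<i> * \<rho>"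

definition triangle :: "real \<Rightarrow> (real \<times> real) set" where
  "triangle l = {(x, t). 0 \<le> x \<and> x \<le> l \<and> \<bar>t\<bar> \<le> x}"

definition transmute :: "(real \<Rightarrow> real \<Rightarrow> complex) \<Rightarrow> (real \<Rightarrow> complex) \<Rightarrow> real \<Rightarrow> complex" where
  "transmute K y = (\<lambda>x. y x + (LINT t|lebesgue_on {-x<..<x}. K x t * y t))"

text \<open>The integral equation at every \<open>x\<close> determines \<open>K x\<close> up to null sets, so \<open>transmute K y\<close> does
  not depend on the choice of \<open>K\<close>. The solution \<open>e\<close> is unique on \<open>{0..l}\<close>.\<close>

definition is_transmutation_kernel ::
  "real \<Rightarrow> (real \<Rightarrow> complex) \<Rightarrow> (real \<Rightarrow> real \<Rightarrow> complex) \<Rightarrow> bool" where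
  "is_transmutation_kernel l f K \<longleftrightarrow>
     (\<lambda>(x, t). K x t) \<in> L2 (triangle l) \<and>
     (\<forall>x \<in> {0<..l}. K x \<in> L2 {-x<..<x}) \<and>
     (\<forall>\<rho>. \<exists>e. is_e_solution l f \<rho> e \<and>
        (\<forall>x \<in> {0<..l}. e x = exp (\<i> * \<rho> * complex_of_real x) +
           (LINT t|lebesgue_on {-x<..<x}. K x t * exp (\<i> * \<rho> * complex_of_real t))))"

end

theory Submission imports Defs begin

text \<open>
  The identity is checked on the exponentials \<open>exp (k t)\<close>, \<open>k \<in> \<nat>\<close>, i.e. \<open>\<rho> = - \<i> k\<close>, and then
  extended by density. For an exponential the two operators give the solutions \<open>e\<close> and \<open>e'\<close> of the
  equations for \<open>f\<close> and \<open>1/f\<close>, so that it says \<open>D\<^sub>f e = \<i> \<rho> e'\<close>. Integrating both equations once, the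
  differences \<open>A = D\<^sub>f e - \<i> \<rho> e'\<close> and \<open>B = D\<^bsub>1/f\<^esub> e' - \<i> \<rho> e\<close> satisfy the homogeneous Volterra system
  \<open>f A = - \<i> \<rho> \<integral> f B\<close>, \<open>B / f = - \<i> \<rho> \<integral> A / f\<close>, hence vanish by Gronwall's inequality.

  Linear combinations of the \<open>exp (k t)\<close> with \<open>k \<ge> 1\<close> are dense in \<open>L\<^sup>2\<close> by the Weierstrass theorem
  in the variable \<open>exp t\<close>; applied to \<open>y'\<close> and integrated, this approximates \<open>y\<close> uniformly and \<open>y'\<close>
  in \<open>L\<^sup>2\<close>. The integrated form \<open>T\<^sub>f y / f = y(0) + \<integral> T\<^bsub>1/f\<^esub> y' / f\<close> survives the limit, since the
  \<open>L\<^sup>2\<close> norm of the row \<open>K x\<close> is square integrable in \<open>x\<close> by Tonelli's theorem.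
\<close>

section \<open>Square integrable functions\<close>

text \<open>The kernel is given only through its pairings with exponentials and carries no
  regularity in \<open>x\<close>, so the integral operator cannot be differentiated directly.
  Statements about derivatives are therefore moved to an integrated form: a Sobolev function is
  handled through its continuous representative \<open>Y x = Y a + integral {a..x} g\<close>, and
  this form is stable under the limits taken here. Real exponents \<open>k\<close> make the
  exponentials powers of \<open>exp t\<close>, so that density reduces to polynomial approximation.
  Excluding \<open>k = 0\<close> in the approximation of \<open>y'\<close> matters because the
  primitive of such a sum is again an exponential sum, whereas a constant would integrate to
  \<open>t\<close>; the exponent \<open>0\<close> then stays free to match an initial value. The
  Volterra system has no constant terms because the initial data match: the quasi-derivative of
  \<open>e\<close> and \<open>\<i> * \<rho> * e'\<close> both equal \<open>\<i> * \<rho>\<close> at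
  \<open>0\<close>, and likewise with the roles exchanged. Since \<open>weak_deriv\<close> is a
  choice, uniqueness of weak derivatives is needed too, and it rests on the same density of
  exponential sums.\<close>

definition L2m :: "'a measure \<Rightarrow> ('a \<Rightarrow> complex) set" where
  "L2m M = {u \<in> borel_measurable M. integrable M (\<lambda>x. (cmod (u x))\<^sup>2)}"

lemma L2_eq_L2m: "L2 A = L2m (lebesgue_on A)"
  by (simp add: L2_def L2m_def)

lemma L2m_measurable: "u \<in> L2m M \<Longrightarrow> u \<in> borel_measurable M"
  and L2m_integrable_sq: "u \<in> L2m M \<Longrightarrow> integrable M (\<lambda>x. (cmod (u x))\<^sup>2)"
  by (auto simp: L2m_def)

lemma L2m_bound:
  assumes "u \<in> borel_measurable M" "integrable M w" "AE x in M. (cmod (u x))\<^sup>2 \<le> w x"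
  shows "u \<in> L2m M"
proof -
  have "AE x in M. norm ((cmod (u x))\<^sup>2) \<le> norm (w x)"
    using assms(3) by eventually_elim simp
  then have "integrable M (\<lambda>x. (cmod (u x))\<^sup>2)"
    using assms(1) by (intro Bochner_Integration.integrable_bound[OF assms(2)]) auto
  then show ?thesis using assms(1) by (simp add: L2m_def)
qed

lemma sq_norm_add_le: "(norm (a + b))\<^sup>2 \<le> 2 * (norm a)\<^sup>2 + 2 * (norm (b::'a::real_normed_vector))\<^sup>2"
proof -
  have "(norm (a + b))\<^sup>2 \<le> (norm a + norm b)\<^sup>2"
    by (intro power_mono norm_triangle_ineq) simp
  also have "\<dots> \<le> 2 * (norm a)\<^sup>2 + 2 * (norm b)\<^sup>2"
    using sum_squares_bound[of "norm a" "norm b"] by (simp add: power2_sum)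
  finally show ?thesis .
qed

lemma L2m_add: assumes "u \<in> L2m M" "v \<in> L2m M" shows "(\<lambda>x. u x + v x) \<in> L2m M"
proof (rule L2m_bound)
  show "(\<lambda>x. u x + v x) \<in> borel_measurable M"
    using assms by (intro borel_measurable_add L2m_measurable)
  show "integrable M (\<lambda>x. 2 * (cmod (u x))\<^sup>2 + 2 * (cmod (v x))\<^sup>2)"
    by (intro Bochner_Integration.integrable_add integrable_mult_right L2m_integrable_sq assms)
qed (use sq_norm_add_le in auto)

lemma L2m_mult_bounded:
  assumes u: "u \<in> L2m M" and m: "w \<in> borel_measurable M" and B: "AE x in M. cmod (w x) \<le> B"
  shows "(\<lambda>x. w x * u x) \<in> L2m M"
proof (rule L2m_bound)
  show "(\<lambda>x. w x * u x) \<in> borel_measurable M"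
    using borel_measurable_times[OF m L2m_measurable[OF u]] .
  show "integrable M (\<lambda>x. B\<^sup>2 * (cmod (u x))\<^sup>2)"
    by (intro integrable_mult_right L2m_integrable_sq u)
  show "AE x in M. (cmod (w x * u x))\<^sup>2 \<le> B\<^sup>2 * (cmod (u x))\<^sup>2"
    using B by eventually_elim (auto simp: norm_mult power_mult_distrib intro!: mult_right_mono power_mono)
qed

lemma L2m_cmult: "u \<in> L2m M \<Longrightarrow> (\<lambda>x. c * u x) \<in> L2m M"
  by (rule L2m_mult_bounded[where B = "cmod c"]) auto

lemma L2m_uminus: "u \<in> L2m M \<Longrightarrow> (\<lambda>x. - u x) \<in> L2m M"
  using L2m_cmult[of u M "-1"] by simp

lemma L2m_diff: "u \<in> L2m M \<Longrightarrow> v \<in> L2m M \<Longrightarrow> (\<lambda>x. u x - v x) \<in> L2m M"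
  using L2m_add[of u M "\<lambda>x. - v x"] L2m_uminus[of v M] by simp

lemma L2m_bounded:
  assumes "finite_measure M" "w \<in> borel_measurable M" "AE x in M. cmod (w x) \<le> B"
  shows "w \<in> L2m M"
proof -
  interpret finite_measure M by fact
  have "(\<lambda>x. 1) \<in> L2m M" by (simp add: L2m_def)
  from L2m_mult_bounded[OF this assms(2,3)] show ?thesis by simp
qed

lemma L2m_cnj: "u \<in> L2m M \<Longrightarrow> (\<lambda>x. cnj (u x)) \<in> L2m M"
  by (auto simp: L2m_def intro!: measurable_compose[of u M borel cnj] borel_measurable_continuous_onI
        continuous_on_cnj)

lemma L2m_cong_AE:
  assumes "u \<in> L2m M" "v \<in> borel_measurable M" "AE x in M. u x = v x"
  shows "v \<in> L2m M"
proof (rule L2m_bound[OF assms(2) L2m_integrable_sq[OF assms(1)]])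
  show "AE x in M. (cmod (v x))\<^sup>2 \<le> (cmod (u x))\<^sup>2" using assms(3) by eventually_elim simp
qed

lemma L2m_integrable_mult:
  assumes "u \<in> L2m M" "v \<in> L2m M" shows "integrable M (\<lambda>x. u x * v x)"
proof (rule Bochner_Integration.integrable_bound)
  show "integrable M (\<lambda>x. (cmod (u x))\<^sup>2 + (cmod (v x))\<^sup>2)"
    using assms by (auto intro: L2m_integrable_sq)
  show "(\<lambda>x. u x * v x) \<in> borel_measurable M"
    using assms by (intro borel_measurable_times L2m_measurable)
  show "AE x in M. cmod (u x * v x) \<le> norm ((cmod (u x))\<^sup>2 + (cmod (v x))\<^sup>2)"
  proof (rule AE_I2)
    fix x
    have "0 \<le> cmod (u x) * cmod (v x)" by simp
    then have "cmod (u x) * cmod (v x) \<le> (cmod (u x))\<^sup>2 + (cmod (v x))\<^sup>2"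
      using sum_squares_bound[of "cmod (u x)" "cmod (v x)"] by linarith
    then show "cmod (u x * v x) \<le> norm ((cmod (u x))\<^sup>2 + (cmod (v x))\<^sup>2)"
      by (simp add: norm_mult)
  qed
qed

lemma L2m_integrable:
  assumes "finite_measure M" "u \<in> L2m M" shows "integrable M u"
proof -
  interpret finite_measure M by fact
  have "(\<lambda>x. 1) \<in> L2m M" by (simp add: L2m_def)
  from L2m_integrable_mult[OF this assms(2)] show ?thesis by simp
qed

section \<open>Cauchy-Schwarz and convergence of pairings\<close>

text \<open>The integral of \<open>(t * cmod (u x) - cmod (v x))\<^sup>2\<close> is a nonnegative
  quadratic in \<open>t\<close>, and its value at the minimum \<open>t = c / a\<close> is the
  inequality. When \<open>a = 0\<close>, \<open>u\<close> vanishes almost everywhere and the left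
  side is zero.\<close>

lemma L2m_Cauchy_Schwarz:
  assumes u: "u \<in> L2m M" and v: "v \<in> L2m M"
  shows "(LINT x|M. cmod (u x * v x))\<^sup>2 \<le>
    (LINT x|M. (cmod (u x))\<^sup>2) * (LINT x|M. (cmod (v x))\<^sup>2)"
proof -
  define a b c where "a = (LINT x|M. (cmod (u x))\<^sup>2)" and "b = (LINT x|M. (cmod (v x))\<^sup>2)"
    and "c = (LINT x|M. cmod (u x * v x))"
  have iu: "integrable M (\<lambda>x. (cmod (u x))\<^sup>2)" and iv: "integrable M (\<lambda>x. (cmod (v x))\<^sup>2)"
    and iuv: "integrable M (\<lambda>x. cmod (u x * v x))"
    using assms by (auto intro: L2m_integrable_sq L2m_integrable_mult)
  have quad: "0 \<le> t\<^sup>2 * a - 2 * t * c + b" for t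
  proof -
    have "0 \<le> (LINT x|M. (t * cmod (u x) - cmod (v x))\<^sup>2)" by simp
    also have "\<dots> = (LINT x|M. t\<^sup>2 * (cmod (u x))\<^sup>2 - (2 * t) * cmod (u x * v x) + (cmod (v x))\<^sup>2)"
      by (simp add: power2_eq_square algebra_simps norm_mult)
    also have "\<dots> = t\<^sup>2 * a - 2 * t * c + b"
      unfolding a_def b_def c_def using iu iv iuv by simp
    finally show ?thesis .
  qed
  have a0: "0 \<le> a" by (simp add: a_def)
  have "c\<^sup>2 \<le> a * b"
  proof (cases "a = 0")
    case True
    then have "AE x in M. (cmod (u x))\<^sup>2 = 0"
      using integral_nonneg_eq_0_iff_AE[OF iu] by (simp add: a_def)
    then have "AE x in M. cmod (u x * v x) = 0" by eventually_elim simp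
    then have "c = 0" unfolding c_def by (rule integral_eq_zero_AE)
    with True show ?thesis by simp
  next
    case False
    with a0 have "a > 0" by simp
    have "0 \<le> a * ((c/a)\<^sup>2 * a - 2 * (c/a) * c + b)"
      using quad[of "c/a"] a0 by (simp only: mult_nonneg_nonneg)
    also have "\<dots> = a * b - c\<^sup>2" using \<open>a > 0\<close> by (simp add: field_simps power2_eq_square)
    finally show ?thesis by simp
  qed
  then show ?thesis by (simp add: a_def b_def c_def)
qed

lemma L2m_norm_integral_mult_le:
  assumes u: "u \<in> L2m M" and v: "v \<in> L2m M"
  shows "cmod (LINT x|M. u x * v x) \<le>
    sqrt (LINT x|M. (cmod (u x))\<^sup>2) * sqrt (LINT x|M. (cmod (v x))\<^sup>2)"
proof -
  have "cmod (LINT x|M. u x * v x) \<le> (LINT x|M. cmod (u x * v x))" by (rule integral_norm_bound)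
  also have "\<dots> \<le> sqrt ((LINT x|M. (cmod (u x))\<^sup>2) * (LINT x|M. (cmod (v x))\<^sup>2))"
    using L2m_Cauchy_Schwarz[OF assms] by (rule real_le_rsqrt)
  finally show ?thesis by (simp add: real_sqrt_mult)
qed

text \<open>The error is the pairing of \<open>u\<close> with \<open>vn n - v\<close>, which
  Cauchy-Schwarz controls. The fixed factor \<open>u\<close> will be a kernel row, a test function
  or \<open>1 / f\<close>.\<close>

lemma L2m_weak_limit:
  assumes u: "u \<in> L2m M" and v: "v \<in> L2m M" and vn: "\<And>n. vn n \<in> L2m M"
    and lim: "(\<lambda>n. LINT x|M. (cmod (vn n x - v x))\<^sup>2) \<longlonglongrightarrow> 0"
  shows "(\<lambda>n. LINT x|M. u x * vn n x) \<longlonglongrightarrow> (LINT x|M. u x * v x)"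
proof (rule LIM_zero_cancel, rule Lim_null_comparison)
  have d: "(\<lambda>x. vn n x - v x) \<in> L2m M" for n by (intro L2m_diff vn v)
  show "\<forall>\<^sub>F n in sequentially. norm ((LINT x|M. u x * vn n x) - (LINT x|M. u x * v x))
    \<le> sqrt (LINT x|M. (cmod (u x))\<^sup>2) * sqrt (LINT x|M. (cmod (vn n x - v x))\<^sup>2)"
  proof (rule always_eventually, rule allI)
    fix n
    have "(LINT x|M. u x * vn n x) - (LINT x|M. u x * v x) = (LINT x|M. u x * (vn n x - v x))"
      using L2m_integrable_mult[OF u vn] L2m_integrable_mult[OF u v]
      by (simp add: algebra_simps)
    then show "norm ((LINT x|M. u x * vn n x) - (LINT x|M. u x * v x))
      \<le> sqrt (LINT x|M. (cmod (u x))\<^sup>2) * sqrt (LINT x|M. (cmod (vn n x - v x))\<^sup>2)"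
      using L2m_norm_integral_mult_le[OF u d] by simp
  qed
  show "(\<lambda>n. sqrt (LINT x|M. (cmod (u x))\<^sup>2) * sqrt (LINT x|M. (cmod (vn n x - v x))\<^sup>2)) \<longlonglongrightarrow> 0"
    using tendsto_mult[OF tendsto_const tendsto_real_sqrt[OF lim], of "sqrt (LINT x|M. (cmod (u x))\<^sup>2)"]
    by simp
qed

section \<open>Square integrable functions on real intervals\<close>

lemma finite_measure_lebesgue_on_interval:
  fixes a b :: real
  shows "finite_measure (lebesgue_on {a<..<b})" "finite_measure (lebesgue_on {a..b})"
  by (rule finite_measure_lebesgue_on; simp)+

lemma continuous_on_measurable_open:
  fixes u :: "real \<Rightarrow> complex"
  assumes "continuous_on {a<..<b} u"
  shows "u \<in> borel_measurable (lebesgue_on {a<..<b})"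
  by (rule continuous_imp_measurable_on_sets_lebesgue[OF assms]) simp

lemma continuous_on_L2:
  fixes u :: "real \<Rightarrow> complex"
  assumes u: "continuous_on {a..b} u"
  shows "u \<in> L2 {a<..<b}"
proof -
  have "bounded (u ` {a..b})"
    using compact_continuous_image[OF u] compact_imp_bounded by blast
  then obtain B where "\<And>x. x \<in> {a..b} \<Longrightarrow> cmod (u x) \<le> B"
    unfolding bounded_iff by (meson imageI)
  then show ?thesis unfolding L2_eq_L2m
    by (intro L2m_bounded[where B = B] finite_measure_lebesgue_on_interval continuous_on_measurable_open
        continuous_on_subset[OF u] AE_I2) auto
qed

lemma L2_mult_continuous:
  fixes u w :: "real \<Rightarrow> complex"
  assumes u: "continuous_on {a..b} u" and w: "w \<in> L2 {a<..<b}"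
  shows "(\<lambda>x. u x * w x) \<in> L2 {a<..<b}"
proof -
  have "bounded (u ` {a..b})"
    using compact_continuous_image[OF u] compact_imp_bounded by blast
  then obtain B where "\<And>x. x \<in> {a..b} \<Longrightarrow> cmod (u x) \<le> B"
    unfolding bounded_iff by (meson imageI)
  then show ?thesis using w unfolding L2_eq_L2m
    by (intro L2m_mult_bounded[where B = B] continuous_on_measurable_open
        continuous_on_subset[OF u] AE_I2) auto
qed

lemma L2_subset:
  assumes "u \<in> L2 A" "B \<subseteq> A" "A \<in> sets lebesgue" "B \<in> sets lebesgue"
  shows "u \<in> L2 B"
proof -
  have 1: "u \<in> borel_measurable (lebesgue_on B)"
    using assms measurable_restrict_mono by (auto simp: L2_def)
  have "integrable (lebesgue_on A) (\<lambda>x. (cmod (u x))\<^sup>2)" using assms(1) by (simp add: L2_def)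
  then have "set_integrable lebesgue A (\<lambda>x. (cmod (u x))\<^sup>2)"
    using assms(3) by (simp add: set_integrable_def integrable_restrict_space)
  then have "set_integrable lebesgue B (\<lambda>x. (cmod (u x))\<^sup>2)"
    by (rule set_integrable_subset) fact+
  then have "integrable (lebesgue_on B) (\<lambda>x. (cmod (u x))\<^sup>2)"
    using assms(4) by (simp add: set_integrable_def integrable_restrict_space)
  with 1 show ?thesis by (simp add: L2_def)
qed

section \<open>Density of exponential sums\<close>

text \<open>The radial projection onto the closed disc of radius \<open>M\<close>. The denominator
  is at least \<open>M\<close>, so no case distinction is needed for continuity.\<close>

definition clip :: "real \<Rightarrow> complex \<Rightarrow> complex" where
  "clip M z = complex_of_real (M / max M (cmod z)) * z"

lemma clip_eq: "0 < M \<Longrightarrow> cmod z \<le> M \<Longrightarrow> clip M z = z"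
  by (simp add: clip_def max_def)

lemma norm_clip_le: assumes "0 < M" shows "cmod (clip M z) \<le> M"
proof -
  have "cmod (clip M z) = M * cmod z / max M (cmod z)"
    using assms by (simp add: clip_def norm_mult norm_divide)
  also have "\<dots> \<le> M" using assms by (simp add: divide_le_eq)
  finally show ?thesis .
qed

lemma norm_diff_clip_le: assumes "0 < M" shows "cmod (z - clip M z) \<le> cmod z"
proof -
  have "z - clip M z = complex_of_real (1 - M / max M (cmod z)) * z"
    by (simp add: clip_def algebra_simps)
  moreover have "\<bar>1 - M / max M (cmod z)\<bar> \<le> 1"
    using assms by (auto simp: abs_le_iff divide_le_eq)
  ultimately show ?thesis by (simp only: norm_mult norm_of_real mult_left_le_one_le norm_ge_zero abs_ge_zero)
qed

lemma continuous_on_clip: assumes "0 < M" shows "continuous_on S (clip M)"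
proof -
  have "max M (cmod z) \<noteq> 0" for z using assms by linarith
  then show ?thesis unfolding clip_def by (intro continuous_intros) auto
qed

text \<open>Measurability supplies continuous functions converging almost everywhere, but without a
  common bound. Truncation repairs this: \<open>clip M v\<close> is close to \<open>v\<close> in the
  mean for large \<open>M\<close>, and at fixed \<open>M\<close> the functions
  \<open>clip M (g n)\<close> converge boundedly to \<open>clip M v\<close>, so dominated
  convergence applies twice.\<close>

lemma L2_continuous_dense:
  fixes v :: "real \<Rightarrow> complex"
  assumes v: "v \<in> L2 {a<..<b}" and e: "0 < e"
  shows "\<exists>h. continuous_on UNIV h \<and> (LINT t|lebesgue_on {a<..<b}. (cmod (v t - h t))\<^sup>2) < e"
proof -
  let ?M = "lebesgue_on {a<..<b}"
  interpret finite_measure ?M by (rule finite_measure_lebesgue_on_interval)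
  have vm: "v \<in> borel_measurable ?M" and vi: "integrable ?M (\<lambda>t. (cmod (v t))\<^sup>2)"
    using v by (auto simp: L2_def)
  have "v measurable_on {a<..<b}"
    using vm by (simp add: measurable_on_iff_borel_measurable)
  \<comment> \<open>By its definition, \<open>measurable_on\<close> provides a sequence of
    continuous functions on the whole line that converges off a negligible set.\<close>
  then obtain N g where N: "negligible N" and g: "\<And>n. continuous_on UNIV (g n)"
    and lim: "\<And>x. x \<notin> N \<Longrightarrow> (\<lambda>n. g n x) \<longlonglongrightarrow> (if x \<in> {a<..<b} then v x else 0)"
    unfolding measurable_on_def by blast
  have AElim: "AE x in ?M. (\<lambda>n. g n x) \<longlonglongrightarrow> v x"
  proof -
    have "AE x in lebesgue. x \<notin> N"
      using N by (intro AE_not_in) (simp add: negligible_iff_null_sets)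
    then have "AE x in lebesgue. x \<in> {a<..<b} \<longrightarrow> (\<lambda>n. g n x) \<longlonglongrightarrow> v x"
      by eventually_elim (use lim in force)
    then show ?thesis by (subst AE_restrict_space_iff) auto
  qed
  have clipm: "clip M \<in> borel_measurable borel" if "0 < M" for M
    by (intro borel_measurable_continuous_onI continuous_on_clip that)
  have clipv: "(\<lambda>t. clip M (v t)) \<in> borel_measurable ?M" if "0 < M" for M
    using measurable_compose[OF vm clipm[OF that]] .
  have gm: "(\<lambda>t. clip M (g n t)) \<in> borel_measurable ?M" if "0 < M" for M n
  proof -
    have "g n \<in> borel_measurable ?M"
      by (intro continuous_imp_measurable_on_sets_lebesgue continuous_on_subset[OF g]) auto
    from measurable_compose[OF this clipm[OF that]] show ?thesis .
  qed
  have "(\<lambda>n. LINT t|?M. (cmod (v t - clip (real (Suc n)) (v t)))\<^sup>2) \<longlonglongrightarrow> (LINT t|?M. 0)"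
  proof (rule integral_dominated_convergence)
    show "integrable ?M (\<lambda>t. (cmod (v t))\<^sup>2)" by fact
    show "(\<lambda>t. (cmod (v t - clip (real (Suc n)) (v t)))\<^sup>2) \<in> borel_measurable ?M" for n
      using vm clipv[of "real (Suc n)"] by simp
    show "AE t in ?M. (\<lambda>n. (cmod (v t - clip (real (Suc n)) (v t)))\<^sup>2) \<longlonglongrightarrow> 0"
    proof (intro AE_I2 tendsto_eventually)
      fix t
      obtain n0 :: nat where n0: "cmod (v t) \<le> real n0" using real_arch_simple by blast
      have "(cmod (v t - clip (real (Suc n)) (v t)))\<^sup>2 = 0" if "n \<ge> n0" for n
        using n0 that by (subst clip_eq) auto
      then show "\<forall>\<^sub>F n in sequentially. (cmod (v t - clip (real (Suc n)) (v t)))\<^sup>2 = 0"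
        by (rule eventually_sequentiallyI)
    qed
    show "AE t in ?M. norm ((cmod (v t - clip (real (Suc n)) (v t)))\<^sup>2) \<le> (cmod (v t))\<^sup>2" for n
      by (intro AE_I2) (auto intro!: power_mono norm_diff_clip_le)
  qed simp
  then have "\<forall>\<^sub>F n in sequentially. (LINT t|?M. (cmod (v t - clip (real (Suc n)) (v t)))\<^sup>2) < e / 4"
    using e by (intro order_tendstoD(2)) auto
  then obtain m where m: "(LINT t|?M. (cmod (v t - clip (real (Suc m)) (v t)))\<^sup>2) < e / 4"
    using eventually_happens'[OF sequentially_bot] by blast
  define M where "M = real (Suc m)"
  have M: "0 < M" by (simp add: M_def)
  have "(\<lambda>n. LINT t|?M. (cmod (clip M (v t) - clip M (g n t)))\<^sup>2) \<longlonglongrightarrow> (LINT t|?M. 0)"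
  proof (rule integral_dominated_convergence)
    show "integrable ?M (\<lambda>t. (2 * M)\<^sup>2)" by simp
    show "(\<lambda>t. (cmod (clip M (v t) - clip M (g n t)))\<^sup>2) \<in> borel_measurable ?M" for n
      using clipv[OF M] gm[OF M, of n] by simp
    show "AE t in ?M. (\<lambda>n. (cmod (clip M (v t) - clip M (g n t)))\<^sup>2) \<longlonglongrightarrow> 0"
      using AElim
    proof eventually_elim
      case (elim t)
      have "(\<lambda>n. clip M (g n t)) \<longlonglongrightarrow> clip M (v t)"
        using continuous_on_clip[OF M, of UNIV] elim
        by (metis UNIV_I continuous_on_eq_continuous_at isCont_tendsto_compose open_UNIV)
      from tendsto_diff[OF tendsto_const[of "clip M (v t)"] this]
      have "(\<lambda>n. clip M (v t) - clip M (g n t)) \<longlonglongrightarrow> 0" by simp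
      from tendsto_power[OF tendsto_norm[OF this], of 2] show ?case by simp
    qed
    show "AE t in ?M. norm ((cmod (clip M (v t) - clip M (g n t)))\<^sup>2) \<le> (2 * M)\<^sup>2" for n
    proof (rule AE_I2)
      fix t
      have "cmod (clip M (v t) - clip M (g n t)) \<le> cmod (clip M (v t)) + cmod (clip M (g n t))"
        by (rule norm_triangle_ineq4)
      also have "\<dots> \<le> 2 * M" using norm_clip_le[OF M, of "v t"] norm_clip_le[OF M, of "g n t"] by linarith
      finally show "norm ((cmod (clip M (v t) - clip M (g n t)))\<^sup>2) \<le> (2 * M)\<^sup>2"
        unfolding real_norm_def abs_power2 by (rule power_mono) simp
    qed
  qed simp
  then have "\<forall>\<^sub>F n in sequentially. (LINT t|?M. (cmod (clip M (v t) - clip M (g n t)))\<^sup>2) < e / 4"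
    using e by (intro order_tendstoD(2)) auto
  then obtain n where n: "(LINT t|?M. (cmod (clip M (v t) - clip M (g n t)))\<^sup>2) < e / 4"
    using eventually_happens'[OF sequentially_bot] by blast
  define h where "h t = clip M (g n t)" for t
  have hc: "continuous_on UNIV h" unfolding h_def
    by (rule continuous_on_compose2[OF continuous_on_clip[OF M] g]) auto
  have c2: "(\<lambda>t. clip M (v t)) \<in> L2m ?M"
    using norm_clip_le[OF M] by (intro L2m_bounded[where B = M] clipv M AE_I2) (auto intro: finite_measure_axioms)
  have h2: "h \<in> L2m ?M"
    using norm_clip_le[OF M] gm[OF M, of n] unfolding h_def[abs_def]
    by (intro L2m_bounded[where B = M] AE_I2) (auto intro: finite_measure_axioms)
  have v2: "v \<in> L2m ?M" using v by (simp add: L2_eq_L2m)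
  have "(LINT t|?M. (cmod (v t - h t))\<^sup>2) \<le>
    (LINT t|?M. 2 * (cmod (v t - clip M (v t)))\<^sup>2 + 2 * (cmod (clip M (v t) - h t))\<^sup>2)"
  proof (rule integral_mono)
    show "integrable ?M (\<lambda>t. (cmod (v t - h t))\<^sup>2)"
      by (intro L2m_integrable_sq L2m_diff v2 h2)
    show "integrable ?M (\<lambda>t. 2 * (cmod (v t - clip M (v t)))\<^sup>2 + 2 * (cmod (clip M (v t) - h t))\<^sup>2)"
      by (intro Bochner_Integration.integrable_add integrable_mult_right L2m_integrable_sq L2m_diff v2 h2 c2)
    show "(cmod (v t - h t))\<^sup>2 \<le> 2 * (cmod (v t - clip M (v t)))\<^sup>2 + 2 * (cmod (clip M (v t) - h t))\<^sup>2" for t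
      using sq_norm_add_le[of "v t - clip M (v t)" "clip M (v t) - h t"] by simp
  qed
  also have "\<dots> = 2 * (LINT t|?M. (cmod (v t - clip M (v t)))\<^sup>2) + 2 * (LINT t|?M. (cmod (clip M (v t) - h t))\<^sup>2)"
    by (subst Bochner_Integration.integral_add)
      (intro integrable_mult_right L2m_integrable_sq L2m_diff v2 h2 c2, simp)+
  also have "\<dots> < e" using m n by (simp add: M_def h_def)
  finally show ?thesis using hc by blast
qed

section \<open>Exponential sums and polynomial approximation\<close>

definition expsum :: "(nat \<Rightarrow> complex) \<Rightarrow> nat \<Rightarrow> real \<Rightarrow> complex" where
  "expsum c n t = (\<Sum>k\<le>n. c k * exp (of_nat k * complex_of_real t))"

lemma continuous_on_expsum: "continuous_on S (expsum c n)"
  unfolding expsum_def by (intro continuous_intros)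

text \<open>Substituting \<open>s = exp t\<close> turns exponential sums into polynomials.
  Approximating \<open>h (ln s) / s\<close> rather than \<open>h (ln s)\<close> leaves a spare
  factor \<open>exp t\<close>, so only exponents \<open>Suc k\<close> occur and no constant term is
  produced.\<close>

lemma expsum_uniformly_dense_real:
  fixes h :: "real \<Rightarrow> real"
  assumes h: "continuous_on {a..b} h" and e: "0 < e"
  shows "\<exists>c n. \<forall>t\<in>{a..b}. \<bar>h t - (\<Sum>k\<le>n. c k * exp t ^ Suc k)\<bar> < e"
proof -
  have pos: "0 < s" if "s \<in> {exp a..exp b}" for s
    using that by (meson exp_gt_zero atLeastAtMost_iff less_le_trans)
  have "continuous_on {exp a..exp b} (\<lambda>s. h (ln s) / s)"
  proof (rule continuous_on_divide)
    have "ln s \<in> {a..b}" if "s \<in> {exp a..exp b}" for s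
      using that pos[OF that] ln_mono[of "exp a" s] ln_mono[of s "exp b"] by simp
    then have "ln ` {exp a..exp b} \<subseteq> {a..b}" by blast
    moreover have "continuous_on {exp a..exp b} (ln :: real \<Rightarrow> real)"
      by (intro continuous_on_ln continuous_on_id) (use pos in fastforce)
    ultimately show "continuous_on {exp a..exp b} (\<lambda>s. h (ln s))"
      by (intro continuous_on_compose2[OF h])
    show "\<forall>s\<in>{exp a..exp b}. s \<noteq> 0" using pos by fastforce
  qed (rule continuous_on_id)
  \<comment> \<open>Multiplying back by \<open>exp t \<le> exp b\<close> turns this tolerance into
    \<open>e\<close>.\<close>
  moreover have "0 < e / exp b" using e by simp
  ultimately obtain P where P: "real_polynomial_function P"
    and b: "\<And>s. s \<in> {exp a..exp b} \<Longrightarrow> \<bar>h (ln s) / s - P s\<bar> < e / exp b"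
    using Stone_Weierstrass_real_polynomial_function[of "{exp a..exp b}" "\<lambda>s. h (ln s) / s" "e / exp b"] by auto
  from P obtain c n where c: "P = (\<lambda>x. \<Sum>k\<le>n. c k * x ^ k)"
    unfolding real_polynomial_function_iff_sum by blast
  have "\<bar>h t - (\<Sum>k\<le>n. c k * exp t ^ Suc k)\<bar> < e" if t: "t \<in> {a..b}" for t
  proof -
    have "(\<Sum>k\<le>n. c k * exp t ^ Suc k) = exp t * P (exp t)"
      by (simp add: c sum_distrib_left algebra_simps)
    then have "h t - (\<Sum>k\<le>n. c k * exp t ^ Suc k) = exp t * (h (ln (exp t)) / exp t - P (exp t))"
      by (simp add: algebra_simps)
    then have "\<bar>h t - (\<Sum>k\<le>n. c k * exp t ^ Suc k)\<bar> = exp t * \<bar>h (ln (exp t)) / exp t - P (exp t)\<bar>"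
      by (simp add: abs_mult)
    also have "\<dots> < exp t * (e / exp b)"
      using b[of "exp t"] t by (intro mult_strict_left_mono) auto
    also have "\<dots> \<le> exp b * (e / exp b)"
      using t e by (intro mult_right_mono) auto
    finally show ?thesis by simp
  qed
  then show ?thesis by blast
qed

lemma expsum_uniformly_dense:
  fixes h :: "real \<Rightarrow> complex"
  assumes h: "continuous_on {a..b} h" and e: "0 < e"
  shows "\<exists>c n. c 0 = 0 \<and> (\<forall>t\<in>{a..b}. cmod (h t - expsum c n t) < e)"
proof -
  obtain c1 n1 where 1: "\<forall>t\<in>{a..b}. \<bar>Re (h t) - (\<Sum>k\<le>n1. c1 k * exp t ^ Suc k)\<bar> < e / 2"
    using expsum_uniformly_dense_real[of a b "\<lambda>t. Re (h t)" "e/2"] e continuous_on_Re[OF h] by auto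
  obtain c2 n2 where 2: "\<forall>t\<in>{a..b}. \<bar>Im (h t) - (\<Sum>k\<le>n2. c2 k * exp t ^ Suc k)\<bar> < e / 2"
    using expsum_uniformly_dense_real[of a b "\<lambda>t. Im (h t)" "e/2"] e continuous_on_Im[OF h] by auto
  define n where "n = max n1 n2"
  define d1 where "d1 k = (if k \<le> n1 then c1 k else 0)" for k
  define d2 where "d2 k = (if k \<le> n2 then c2 k else 0)" for k
  \<comment> \<open>The coefficients are shifted by one place, because the real sums start at
    exponent \<open>1\<close>; position \<open>0\<close> is left empty.\<close>
  define c where "c k = (case k of 0 \<Rightarrow> 0 | Suc j \<Rightarrow> Complex (d1 j) (d2 j))" for k
  have s1: "(\<Sum>k\<le>n1. c1 k * x ^ Suc k) = (\<Sum>k\<le>n. d1 k * x ^ Suc k)" for x :: real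
    by (intro sum.mono_neutral_cong_left) (auto simp: n_def d1_def)
  have s2: "(\<Sum>k\<le>n2. c2 k * x ^ Suc k) = (\<Sum>k\<le>n. d2 k * x ^ Suc k)" for x :: real
    by (intro sum.mono_neutral_cong_left) (auto simp: n_def d2_def)
  have ex: "expsum c (Suc n) t = Complex (\<Sum>k\<le>n. d1 k * exp t ^ Suc k) (\<Sum>k\<le>n. d2 k * exp t ^ Suc k)" for t
  proof -
    have "expsum c (Suc n) t = (\<Sum>k\<le>n. Complex (d1 k) (d2 k) * exp (of_nat (Suc k) * complex_of_real t))"
      unfolding expsum_def by (subst sum.atMost_Suc_shift) (simp add: c_def)
    also have "\<dots> = (\<Sum>k\<le>n. Complex (d1 k) (d2 k) * complex_of_real (exp t ^ Suc k))"
      by (simp only: exp_of_nat_mult exp_of_real of_real_power)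
    also have "\<dots> = Complex (\<Sum>k\<le>n. d1 k * exp t ^ Suc k) (\<Sum>k\<le>n. d2 k * exp t ^ Suc k)"
      by (simp add: complex_eq_iff)
    finally show ?thesis .
  qed
  have "cmod (h t - expsum c (Suc n) t) < e" if t: "t \<in> {a..b}" for t
  proof -
    have "cmod (h t - expsum c (Suc n) t) \<le> \<bar>Re (h t - expsum c (Suc n) t)\<bar> + \<bar>Im (h t - expsum c (Suc n) t)\<bar>"
      by (rule cmod_le)
    also have "\<dots> < e" using 1[rule_format, OF t] 2[rule_format, OF t] unfolding s1 s2
      by (simp only: ex minus_complex.sel complex.sel)
    finally show ?thesis .
  qed
  then show ?thesis by (intro exI[of _ c] exI[of _ "Suc n"]) (auto simp: c_def)
qed

lemma L2_expsum_dense: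
  fixes v :: "real \<Rightarrow> complex"
  assumes v: "v \<in> L2 {a<..<b}" and e: "0 < e"
  shows "\<exists>c n. c 0 = 0 \<and> (LINT t|lebesgue_on {a<..<b}. (cmod (expsum c n t - v t))\<^sup>2) < e"
proof -
  let ?M = "lebesgue_on {a<..<b}"
  interpret finite_measure ?M by (rule finite_measure_lebesgue_on_interval)
  obtain h where h: "continuous_on UNIV h" and he: "(LINT t|?M. (cmod (v t - h t))\<^sup>2) < e / 4"
    using L2_continuous_dense[OF v, of "e/4"] e by auto
  define m where "m = measure ?M {a<..<b}"
  have m0: "0 \<le> m" by (simp add: m_def)
  \<comment> \<open>Chosen so that \<open>2 * d\<^sup>2 * m \<le> e / 4\<close>; the
    \<open>+ 1\<close> covers an interval of measure zero. Together with twice the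
    \<open>e / 4\<close> from the continuous approximation the error stays below
    \<open>e\<close>.\<close>
  define d where "d = sqrt (e / (8 * (m + 1)))"
  have d: "0 < d" using e m0 by (simp add: d_def)
  obtain c n where c0: "c 0 = 0" and c: "\<forall>t\<in>{a..b}. cmod (h t - expsum c n t) < d"
    using expsum_uniformly_dense[of a b h d] d continuous_on_subset[OF h] by auto
  have v2: "v \<in> L2m ?M" and h2: "h \<in> L2m ?M" and c2: "expsum c n \<in> L2m ?M"
    using v continuous_on_L2[OF continuous_on_subset[OF h], of a b] continuous_on_L2[OF continuous_on_expsum[of "{a..b}" c n]]
    by (auto simp: L2_eq_L2m)
  have "(LINT t|?M. (cmod (expsum c n t - v t))\<^sup>2) \<le> (LINT t|?M. 2 * (cmod (v t - h t))\<^sup>2 + 2 * d\<^sup>2)"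
  proof (rule integral_mono)
    show "integrable ?M (\<lambda>t. (cmod (expsum c n t - v t))\<^sup>2)"
      by (intro L2m_integrable_sq L2m_diff v2 c2)
    show "integrable ?M (\<lambda>t. 2 * (cmod (v t - h t))\<^sup>2 + 2 * d\<^sup>2)"
      by (intro Bochner_Integration.integrable_add integrable_mult_right L2m_integrable_sq L2m_diff v2 h2) simp
    fix t assume "t \<in> space ?M"
    then have "cmod (h t - expsum c n t) \<le> d" using c by (auto intro: less_imp_le)
    then have "(cmod (h t - expsum c n t))\<^sup>2 \<le> d\<^sup>2" by (rule power_mono) simp
    then show "(cmod (expsum c n t - v t))\<^sup>2 \<le> 2 * (cmod (v t - h t))\<^sup>2 + 2 * d\<^sup>2"
      using sq_norm_add_le[of "v t - h t" "h t - expsum c n t"] by (simp add: norm_minus_commute)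
  qed
  also have "\<dots> = 2 * (LINT t|?M. (cmod (v t - h t))\<^sup>2) + 2 * d\<^sup>2 * m"
    by (subst Bochner_Integration.integral_add)
      (intro integrable_mult_right L2m_integrable_sq L2m_diff v2 h2, simp, simp add: m_def)
  also have "2 * d\<^sup>2 * m \<le> e / 4"
  proof -
    have "2 * d\<^sup>2 * m = (e / 4) * (m / (m + 1))" using e m0 by (simp add: d_def field_simps)
    also have "\<dots> \<le> (e/4) * 1" using e m0 by (intro mult_left_mono) auto
    finally show ?thesis by simp
  qed
  finally show ?thesis using he c0 e by (intro exI[of _ c] exI[of _ n]) linarith
qed

lemma L2_expsum_sequence:
  fixes v :: "real \<Rightarrow> complex"
  assumes v: "v \<in> L2 {a<..<b}"
  shows "\<exists>c N. (\<forall>n. c n 0 = 0) \<and>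
    (\<lambda>n. LINT t|lebesgue_on {a<..<b}. (cmod (expsum (c n) (N n) t - v t))\<^sup>2) \<longlonglongrightarrow> 0"
proof -
  have "\<forall>n. \<exists>c m. c 0 = 0 \<and> (LINT t|lebesgue_on {a<..<b}. (cmod (expsum c m t - v t))\<^sup>2) < inverse (real (Suc n))"
    using L2_expsum_dense[OF v] by simp
  then obtain c N where c0: "\<And>n. c n 0 = 0" and
    c: "\<And>n. (LINT t|lebesgue_on {a<..<b}. (cmod (expsum (c n) (N n) t - v t))\<^sup>2) < inverse (real (Suc n))"
    by metis
  have "(\<lambda>n. LINT t|lebesgue_on {a<..<b}. (cmod (expsum (c n) (N n) t - v t))\<^sup>2) \<longlonglongrightarrow> 0"
    by (rule tendsto_sandwich[OF _ _ tendsto_const LIMSEQ_inverse_real_of_nat])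
      (auto intro!: always_eventually less_imp_le[OF c] simp del: of_nat_Suc)
  with c0 show ?thesis by blast
qed

section \<open>Test functions and the fundamental lemma\<close>

text \<open>Derivatives of \<open>x \<mapsto> inverse x ^ n * exp (- inverse x)\<close> are combinations of functions of the same
  form, which makes the algebra below closed under differentiation and all its members smooth.\<close>

definition flat :: "nat \<Rightarrow> real \<Rightarrow> real" where
  "flat n x = (if 0 < x then inverse x ^ n * exp (- inverse x) else 0)"

lemma flat_tendsto_0: "(flat n \<longlongrightarrow> 0) (at 0)"
proof (rule filterlim_split_at)
  have "\<forall>\<^sub>F x in at_left 0. flat n x = 0"
    unfolding eventually_at_filter by (rule always_eventually) (auto simp: flat_def)
  then show "(flat n \<longlongrightarrow> 0) (at_left 0)" by (rule tendsto_eventually)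
  have "((\<lambda>x. inverse x ^ n / exp (inverse x)) \<longlongrightarrow> 0) (at_right (0::real))"
    by (rule filterlim_compose[OF tendsto_power_div_exp_0 filterlim_inverse_at_top_right])
  moreover have "\<forall>\<^sub>F x in at_right (0::real). inverse x ^ n / exp (inverse x) = flat n x"
    unfolding eventually_at_filter
    by (rule always_eventually) (auto simp: flat_def exp_minus field_simps)
  ultimately show "(flat n \<longlongrightarrow> 0) (at_right 0)" by (rule Lim_transform_eventually)
qed

lemma flat_has_derivative:
  "(flat n has_real_derivative (flat (n + 2) x - real n * flat (n + 1) x)) (at x)"
proof (cases x "0::real" rule: linorder_cases)
  case less
  have "((\<lambda>x. 0) has_real_derivative 0) (at x)" by simp
  then have "(flat n has_real_derivative 0) (at x)"
    by (rule has_field_derivative_transform_within_open[where S = "{..<0}"])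
      (use less in \<open>auto simp: flat_def\<close>)
  then show ?thesis using less by (simp add: flat_def)
next
  case equal
  have "((\<lambda>h. (flat n (0 + h) - flat n 0) / h) \<longlongrightarrow> 0) (at 0)"
  \<comment> \<open>At the origin the difference quotient of \<open>flat n\<close> is
    \<open>flat (Suc n)\<close> itself.\<close>
  proof (rule Lim_transform_eventually[OF flat_tendsto_0[of "Suc n"]])
    show "\<forall>\<^sub>F h in at 0. flat (Suc n) h = (flat n (0 + h) - flat n 0) / h"
      unfolding eventually_at_filter
      by (rule always_eventually) (auto simp: flat_def field_simps)
  qed
  then show ?thesis unfolding equal DERIV_def by (simp add: flat_def)
next
  case greater
  have "((\<lambda>x. inverse x ^ n * exp (- inverse x)) has_real_derivative
      (flat (n + 2) x - real n * flat (n + 1) x)) (at x)"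
  proof (cases n)
    case 0
    show ?thesis unfolding 0 using greater
      by (auto intro!: derivative_eq_intros simp: flat_def power2_eq_square)
  next
    case (Suc m)
    show ?thesis unfolding Suc using greater
      by (auto intro!: derivative_eq_intros simp: flat_def power2_eq_square algebra_simps)
        (cases m; simp)
  qed
  then show ?thesis
    by (rule has_field_derivative_transform_within_open[where S = "{0<..}"])
      (use greater in \<open>auto simp: flat_def\<close>)
qed

text \<open>The exponential generators are included so that an exponential times a smooth cut-off is
  again a member; these products are the test functions of the fundamental lemma.\<close>

inductive_set bump_algebra :: "(real \<Rightarrow> real) set" where
  const: "(\<lambda>x. c) \<in> bump_algebra"
| exp: "(\<lambda>x. exp (k * x)) \<in> bump_algebra"
| flat: "(\<lambda>x. flat n (s * x + c)) \<in> bump_algebra"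
| add: "u \<in> bump_algebra \<Longrightarrow> v \<in> bump_algebra \<Longrightarrow> (\<lambda>x. u x + v x) \<in> bump_algebra"
| mult: "u \<in> bump_algebra \<Longrightarrow> v \<in> bump_algebra \<Longrightarrow> (\<lambda>x. u x * v x) \<in> bump_algebra"

lemma bump_algebra_has_derivative:
  "u \<in> bump_algebra \<Longrightarrow> \<exists>v\<in>bump_algebra. \<forall>x. (u has_real_derivative v x) (at x)"
proof (induction rule: bump_algebra.induct)
  case (const c)
  show ?case by (rule bexI[OF _ bump_algebra.const[of 0]]) simp
next
  case (exp k)
  show ?case
    by (rule bexI[OF _ bump_algebra.mult[OF bump_algebra.const[of k] bump_algebra.exp[of k]]])
      (auto intro!: derivative_eq_intros)
next
  case (flat n s c)
  let ?v = "\<lambda>x. s * (flat (n + 2) (s * x + c) + (- real n) * flat (n + 1) (s * x + c))"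
  have "?v \<in> bump_algebra" by (intro bump_algebra.intros)
  moreover have "((\<lambda>x. flat n (s * x + c)) has_real_derivative ?v x) (at x)" for x
  proof -
    have "((\<lambda>x. s * x + c) has_real_derivative s) (at x)" by (auto intro!: derivative_eq_intros)
    from DERIV_chain2[OF flat_has_derivative this] show ?thesis
      by (simp add: algebra_simps)
  qed
  ultimately show ?case by (intro bexI[of _ ?v] allI)
next
  case (add u v)
  then obtain u' v' where "u' \<in> bump_algebra" "v' \<in> bump_algebra"
    "\<forall>x. (u has_real_derivative u' x) (at x)" "\<forall>x. (v has_real_derivative v' x) (at x)" by blast
  then show ?case by (intro bexI[OF _ bump_algebra.add[of u' v']]) (auto intro: DERIV_add)
next
  case (mult u v)
  then obtain u' v' where *: "u' \<in> bump_algebra" "v' \<in> bump_algebra"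
    "\<forall>x. (u has_real_derivative u' x) (at x)" "\<forall>x. (v has_real_derivative v' x) (at x)" by blast
  have "(\<lambda>x. u' x * v x + v' x * u x) \<in> bump_algebra"
    by (intro bump_algebra.add bump_algebra.mult * mult.hyps)
  moreover have "\<forall>x. ((\<lambda>x. u x * v x) has_real_derivative u' x * v x + v' x * u x) (at x)"
    using * by (auto intro: DERIV_mult)
  ultimately show ?case by (intro bexI[of _ "\<lambda>x. u' x * v x + v' x * u x"])
qed

lemma bump_algebra_smooth:
  assumes "u \<in> bump_algebra"
  shows "(deriv ^^ n) u differentiable (at x)"
proof -
  have "(deriv ^^ n) u \<in> bump_algebra"
  proof (induction n)
    case (Suc n)
    then obtain v where v: "v \<in> bump_algebra" "\<forall>x. ((deriv ^^ n) u has_real_derivative v x) (at x)"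
      using bump_algebra_has_derivative by blast
    then have "deriv ((deriv ^^ n) u) = v" by (auto intro: DERIV_imp_deriv)
    with v show ?case by simp
  qed (use assms in simp)
  then show ?thesis using bump_algebra_has_derivative
    by (meson real_differentiable_def)
qed

lemma bump_algebra_test_function:
  assumes "u \<in> bump_algebra" "a < c" "d < b" "\<And>x. x \<notin> {c..d} \<Longrightarrow> u x = 0"
  shows "u \<in> test_functions a b"
proof -
  have "{x. u x \<noteq> 0} \<subseteq> {c..d}" using assms(4) by blast
  then have "closure {x. u x \<noteq> 0} \<subseteq> {c..d}" by (rule closure_minimal) simp
  also have "\<dots> \<subseteq> {a<..<b}" using assms by auto
  finally show ?thesis using assms(1) by (auto simp: test_functions_def bump_algebra_smooth)
qed

section \<open>Smooth cut-off functions\<close>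

definition bump :: "real \<Rightarrow> real \<Rightarrow> real \<Rightarrow> real" where
  "bump c d x = flat 0 (x - c) * flat 0 (d - x)"

lemma bump_in_algebra: "bump c d \<in> bump_algebra"
  using bump_algebra.mult[OF bump_algebra.flat[of 0 1 "-c"] bump_algebra.flat[of 0 "-1" d]]
  by (simp add: bump_def[abs_def] algebra_simps)

lemma bump_pos: "c < x \<Longrightarrow> x < d \<Longrightarrow> 0 < bump c d x"
  and bump_outside: "\<not> (c < x \<and> x < d) \<Longrightarrow> bump c d x = 0"
  by (auto simp: bump_def flat_def)

lemma bump_nonneg: "0 \<le> bump c d x" and bump_le_1: "bump c d x \<le> 1"
  by (auto simp: bump_def flat_def intro!: mult_le_one)

text \<open>A polynomial in the bump, hence still a member of the smooth algebra. As the bump lies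
  in \<open>(0, 1]\<close> inside the interval and vanishes outside, the powers tend to
  \<open>0\<close> or stay equal to \<open>1\<close>, and the functions converge boundedly to the
  indicator. This replaces mollification.\<close>

definition plateau :: "real \<Rightarrow> real \<Rightarrow> nat \<Rightarrow> real \<Rightarrow> real" where
  "plateau c d n x = 1 - (1 - bump c d x) ^ n"

lemma plateau_in_algebra: "plateau c d n \<in> bump_algebra"
proof -
  have m: "(\<lambda>x. - 1 * u x) \<in> bump_algebra" if "u \<in> bump_algebra" for u
    using that by (intro bump_algebra.intros)
  have 1: "(\<lambda>x. 1 - u x) \<in> bump_algebra" if "u \<in> bump_algebra" for u
    using bump_algebra.add[OF bump_algebra.const[of 1] m[OF that]] by simp
  have "(\<lambda>x. (1 - bump c d x) ^ n) \<in> bump_algebra"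
    by (induction n) (auto intro!: bump_algebra.mult bump_algebra.const 1 bump_in_algebra)
  from 1[OF this] show ?thesis by (simp add: plateau_def[abs_def])
qed

lemma plateau_outside: "\<not> (c < x \<and> x < d) \<Longrightarrow> plateau c d n x = 0"
  by (simp add: plateau_def bump_outside)

lemma abs_plateau_le: "\<bar>plateau c d n x\<bar> \<le> 1"
  using bump_nonneg[of c d x] bump_le_1[of c d x]
    power_le_one[of "1 - bump c d x" n] zero_le_power[of "1 - bump c d x" n]
  by (auto simp: plateau_def abs_le_iff)

lemma plateau_tendsto: "(\<lambda>n. plateau c d n x) \<longlonglongrightarrow> indicat_real {c<..<d} x"
proof (cases "c < x \<and> x < d")
  case True
  then have "(\<lambda>n. (1 - bump c d x) ^ n) \<longlonglongrightarrow> 0"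
    using bump_pos[of c x d] bump_le_1[of c d x] by (intro LIMSEQ_power_zero) auto
  from tendsto_diff[OF tendsto_const[of 1] this] True show ?thesis
    by (simp add: plateau_def)
qed (simp add: plateau_outside)

lemma continuous_on_bump_algebra: "u \<in> bump_algebra \<Longrightarrow> continuous_on S u"
  by (meson DERIV_isCont bump_algebra_has_derivative continuous_at_imp_continuous_on)

text \<open>Testing against \<open>exp (k x)\<close> times plateaus and passing to the limit shows
  that the restriction of \<open>g\<close> to a smaller interval is orthogonal to all exponentials.
  By their density it is orthogonal to its own conjugate, hence zero. Such intervals exhaust the
  whole one.\<close>

lemma fundamental_lemma_L2:
  assumes g: "g \<in> L2 {a<..<b}"
    and orth: "\<And>\<phi>. \<phi> \<in> test_functions a b \<Longrightarrow>
      (LINT x|lebesgue_on {a<..<b}. g x * complex_of_real (\<phi> x)) = 0"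
  shows "AE x in lebesgue_on {a<..<b}. g x = 0"
proof -
  let ?M = "lebesgue_on {a<..<b}"
  have fin: "finite_measure ?M" by (rule finite_measure_lebesgue_on_interval)
  have gm: "g \<in> borel_measurable ?M" and g2: "g \<in> L2m ?M"
    using g by (simp_all add: L2_def L2m_def)
  have gi: "integrable ?M g" by (rule L2m_integrable[OF fin g2])
  have part: "AE x in ?M. c < x \<and> x < d \<longrightarrow> g x = 0" if cd: "a < c" "d < b" for c d
  proof -
    \<comment> \<open>The cut-off at \<open>c\<close> and \<open>d\<close> is needed because an
      exponential alone is not supported inside the open interval.\<close>
    define G where "G x = indicat_real {c<..<d} x * g x" for x
    have Gm: "G \<in> borel_measurable ?M"
    proof -
      have "indicat_real {c<..<d} \<in> borel_measurable ?M"
        by (intro measurable_restrict_space1 borel_measurable_indicator) simp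
      then have "(\<lambda>x. complex_of_real (indicat_real {c<..<d} x)) \<in> borel_measurable ?M" by simp
      from borel_measurable_times[OF this gm] show ?thesis by (simp add: G_def[abs_def])
    qed
    have G2: "G \<in> L2m ?M"
      by (rule L2m_bound[OF Gm L2m_integrable_sq[OF g2]])
        (auto simp: G_def norm_mult indicator_def)
    have zero: "(LINT x|?M. G x * exp (of_nat k * complex_of_real x)) = 0" for k
    proof -
      define w where "w n x = exp (real k * x) * plateau c d n x" for n x
      have w: "w n \<in> test_functions a b" for n
        unfolding w_def[abs_def] using cd
        by (intro bump_algebra_test_function[where c = c and d = d] bump_algebra.mult
            bump_algebra.exp plateau_in_algebra) (auto simp: plateau_outside)
      have "(\<lambda>n. LINT x|?M. g x * complex_of_real (w n x)) \<longlonglongrightarrow>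
        (LINT x|?M. G x * exp (of_nat k * complex_of_real x))"
      proof (rule integral_dominated_convergence)
        show "(\<lambda>x. G x * exp (of_nat k * complex_of_real x)) \<in> borel_measurable ?M"
          by (intro borel_measurable_times Gm continuous_on_measurable_open continuous_intros)
        show "(\<lambda>x. g x * complex_of_real (w n x)) \<in> borel_measurable ?M" for n
          unfolding w_def
          by (intro borel_measurable_times gm continuous_on_measurable_open continuous_intros
              continuous_on_bump_algebra plateau_in_algebra)
        \<comment> \<open>The majorant uses that \<open>x < b\<close> on the interval, that
          \<open>k\<close> is nonnegative and that plateaus are bounded by \<open>1\<close>.\<close>
        show "integrable ?M (\<lambda>x. exp (real k * b) * cmod (g x))"
          using gi by simp
        show "AE x in ?M. (\<lambda>n. g x * complex_of_real (w n x)) \<longlonglongrightarrow> G x * exp (of_nat k * complex_of_real x)"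
        proof (rule AE_I2)
          fix x
          have "(\<lambda>n. g x * complex_of_real (w n x)) \<longlonglongrightarrow>
              g x * complex_of_real (exp (real k * x) * indicat_real {c<..<d} x)"
            unfolding w_def by (intro tendsto_intros plateau_tendsto)
          also have "g x * complex_of_real (exp (real k * x) * indicat_real {c<..<d} x)
              = G x * exp (of_nat k * complex_of_real x)"
            by (simp add: G_def exp_of_real[symmetric])
          finally show "(\<lambda>n. g x * complex_of_real (w n x)) \<longlonglongrightarrow> G x * exp (of_nat k * complex_of_real x)" .
        qed
        show "AE x in ?M. cmod (g x * complex_of_real (w n x)) \<le> exp (real k * b) * cmod (g x)" for n
        proof (rule AE_I2)
          fix x assume "x \<in> space ?M"
          then have "exp (real k * x) \<le> exp (real k * b)" by (auto intro: mult_left_mono)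
          then have "exp (real k * x) * \<bar>plateau c d n x\<bar> \<le> exp (real k * b) * 1"
            using abs_plateau_le by (intro mult_mono) auto
          then have "cmod (g x) * (exp (real k * x) * \<bar>plateau c d n x\<bar>) \<le> cmod (g x) * (exp (real k * b) * 1)"
            by (rule mult_left_mono) simp
          then show "cmod (g x * complex_of_real (w n x)) \<le> exp (real k * b) * cmod (g x)"
            by (simp add: w_def norm_mult abs_mult mult.commute)
        qed
      qed
      then show ?thesis using orth[OF w] by (simp add: LIMSEQ_const_iff)
    qed
    have zero': "(LINT x|?M. G x * expsum c n x) = 0" for c n
    proof -
      have i: "integrable ?M (\<lambda>x. c k * (G x * exp (of_nat k * complex_of_real x)))" for k
        by (intro integrable_mult_right L2m_integrable_mult[OF G2] continuous_on_L2[unfolded L2_eq_L2m]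
            continuous_intros)
      have "(LINT x|?M. G x * expsum c n x) =
          (LINT x|?M. (\<Sum>k\<le>n. c k * (G x * exp (of_nat k * complex_of_real x))))"
        by (simp add: expsum_def sum_distrib_left algebra_simps)
      also have "\<dots> = 0" by (subst Bochner_Integration.integral_sum) (use i zero in auto)
      finally show ?thesis .
    qed
    \<comment> \<open>The pairing is bilinear, so approximating the conjugate is what produces the
      integral of \<open>(cmod (G x))\<^sup>2\<close>.\<close>
    have cG: "(\<lambda>x. cnj (G x)) \<in> L2m ?M" using G2 by (rule L2m_cnj)
    obtain e N where lim: "(\<lambda>n. LINT t|?M. (cmod (expsum (e n) (N n) t - cnj (G t)))\<^sup>2) \<longlonglongrightarrow> 0"
      using L2_expsum_sequence[OF cG[folded L2_eq_L2m]] by blast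
    have "(\<lambda>n. LINT x|?M. G x * expsum (e n) (N n) x) \<longlonglongrightarrow> (LINT x|?M. G x * cnj (G x))"
      by (rule L2m_weak_limit[OF G2 cG _ lim])
        (intro continuous_on_L2[unfolded L2_eq_L2m] continuous_on_expsum)
    then have "(LINT x|?M. G x * cnj (G x)) = 0" by (simp add: zero' LIMSEQ_const_iff)
    then have "complex_of_real (LINT x|?M. (cmod (G x))\<^sup>2) = 0"
      by (simp only: complex_norm_square[symmetric] integral_complex_of_real)
    then have "AE x in ?M. (cmod (G x))\<^sup>2 = 0"
      using integral_nonneg_eq_0_iff_AE[OF L2m_integrable_sq[OF G2]] by simp
    then show ?thesis by eventually_elim (auto simp: G_def)
  qed
  have "AE x in ?M. \<forall>n. a + inverse (real (Suc n)) < x \<and> x < b - inverse (real (Suc n)) \<longrightarrow> g x = 0"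
    unfolding AE_all_countable by (intro allI part) auto
  then show ?thesis
  proof (rule AE_mp, intro AE_I2 impI)
    fix x assume x: "x \<in> space ?M"
      and *: "\<forall>n. a + inverse (real (Suc n)) < x \<and> x < b - inverse (real (Suc n)) \<longrightarrow> g x = 0"
    have "0 < min (x - a) (b - x)" using x by simp
    then obtain n where "inverse (real (Suc n)) < min (x - a) (b - x)"
      using reals_Archimedean by blast
    then show "g x = 0" using *[rule_format, of n] by auto
  qed
qed

section \<open>Test functions and uniqueness of weak derivatives\<close>

lemma test_function_has_derivative:
  assumes "\<phi> \<in> test_functions a b" shows "(\<phi> has_real_derivative deriv \<phi> x) (at x)"
proof -
  have "(deriv ^^ 0) \<phi> differentiable (at x)" using assms unfolding test_functions_def by blast
  then show ?thesis by (simp add: DERIV_deriv_iff_real_differentiable)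
qed

lemma test_function_deriv_has_derivative:
  assumes "\<phi> \<in> test_functions a b" shows "(deriv \<phi> has_real_derivative deriv (deriv \<phi>) x) (at x)"
proof -
  have "(deriv ^^ 1) \<phi> differentiable (at x)" using assms unfolding test_functions_def by blast
  then show ?thesis by (simp add: DERIV_deriv_iff_real_differentiable)
qed

lemma continuous_on_test_function:
  assumes "\<phi> \<in> test_functions a b" shows "continuous_on S \<phi>" "continuous_on S (deriv \<phi>)"
  using test_function_has_derivative[OF assms] test_function_deriv_has_derivative[OF assms]
  by (auto intro!: continuous_at_imp_continuous_on DERIV_isCont)

lemma test_function_outside:
  assumes "\<phi> \<in> test_functions a b" "x \<notin> {a<..<b}" shows "\<phi> x = 0"
  using assms closure_subset[of "{x. \<phi> x \<noteq> 0}"] unfolding test_functions_def by blast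

lemma test_function_support:
  assumes ab: "a < b" and \<phi>: "\<phi> \<in> test_functions a b"
  shows "\<exists>c d. a < c \<and> d < b \<and> (\<forall>x. x \<notin> {c..d} \<longrightarrow> \<phi> x = 0)"
proof -
  define S where "S = closure {x. \<phi> x \<noteq> 0}"
  have S: "S \<subseteq> {a<..<b}" using \<phi> by (simp add: S_def test_functions_def)
  have z: "\<phi> x = 0" if "x \<notin> S" for x using that closure_subset[of "{x. \<phi> x \<noteq> 0}"] by (auto simp: S_def)
  have "bounded S" by (rule bounded_subset[of "{a..b}"]) (use S in auto)
  then have "compact S" by (simp add: compact_eq_bounded_closed S_def)
  show ?thesis
  proof (cases "S = {}")
    case True
    \<comment> \<open>For the zero function the bounds are taken in reversed order, which makes
      \<open>{c..d}\<close> empty.\<close>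
    then show ?thesis using ab z by (intro exI[of _ b] exI[of _ a]) auto
  next
    case False
    obtain c where c: "c \<in> S" "\<And>x. x \<in> S \<Longrightarrow> c \<le> x"
      using compact_attains_inf[OF \<open>compact S\<close> False] by blast
    obtain d where d: "d \<in> S" "\<And>x. x \<in> S \<Longrightarrow> x \<le> d"
      using compact_attains_sup[OF \<open>compact S\<close> False] by blast
    show ?thesis using S c d z by (intro exI[of _ c] exI[of _ d]) auto
  qed
qed

lemma test_functions_diff_scale:
  assumes \<phi>: "\<phi> \<in> test_functions a b" and \<eta>: "\<eta> \<in> test_functions a b"
  shows "(\<lambda>x. \<phi> x - r * \<eta> x) \<in> test_functions a b"
proof -
  have d1: "(deriv ^^ n) \<phi> differentiable (at x)" and d2: "(deriv ^^ n) \<eta> differentiable (at x)" for n x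
    using \<phi> \<eta> by (auto simp: test_functions_def)
  have eq: "(deriv ^^ n) (\<lambda>x. \<phi> x - r * \<eta> x) = (\<lambda>x. (deriv ^^ n) \<phi> x - r * (deriv ^^ n) \<eta> x)" for n
  proof (induction n)
    case (Suc n)
    have "deriv (\<lambda>x. (deriv ^^ n) \<phi> x - r * (deriv ^^ n) \<eta> x) x =
        deriv ((deriv ^^ n) \<phi>) x - r * deriv ((deriv ^^ n) \<eta>) x" for x
      using d1[of n x] d2[of n x]
      by (intro DERIV_imp_deriv DERIV_diff DERIV_cmult) (simp_all add: DERIV_deriv_iff_real_differentiable)
    then show ?case by (simp add: Suc)
  qed simp
  have "(deriv ^^ n) (\<lambda>x. \<phi> x - r * \<eta> x) differentiable (at x)" for n x
    unfolding eq by (intro differentiable_diff differentiable_mult d1 d2) simp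
  moreover have "closure {x. \<phi> x - r * \<eta> x \<noteq> 0} \<subseteq> closure ({x. \<phi> x \<noteq> 0} \<union> {x. \<eta> x \<noteq> 0})"
    by (intro closure_mono) auto
  ultimately show ?thesis using \<phi> \<eta> by (auto simp: test_functions_def closure_Un)
qed

lemma lebesgue_on_open_eq_integral:
  fixes u :: "real \<Rightarrow> 'a::euclidean_space"
  assumes "integrable (lebesgue_on {a<..<b}) u"
  shows "(LINT x|lebesgue_on {a<..<b}. u x) = integral {a..b} u"
  using lebesgue_integral_eq_integral[OF assms] by (simp add: integral_open_interval_real)

lemma continuous_integrable_open:
  fixes u :: "real \<Rightarrow> 'a::euclidean_space"
  assumes "continuous_on {a..b} u"
  shows "integrable (lebesgue_on {a<..<b}) u"
proof -
  have "u absolutely_integrable_on {a..b}"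
    using assms by (rule absolutely_integrable_continuous_real)
  then have "u absolutely_integrable_on {a<..<b}"
    by (rule set_integrable_subset) auto
  then show ?thesis by (simp add: absolutely_integrable_imp_integrable)
qed

text \<open>The primitive from \<open>a\<close> vanishes to the left of the support of
  \<open>h\<close> and is constant to its right, where it equals the total integral. The hypothesis
  that this integral is zero is exactly what makes the support compact in the interval.\<close>

lemma test_function_antiderivative:
  assumes ab: "a < b" and h: "h \<in> test_functions a b"
    and z: "(LINT x|lebesgue_on {a<..<b}. h x) = 0"
  shows "\<exists>\<phi>\<in>test_functions a b. deriv \<phi> = h"
proof -
  obtain c d where cd: "a < c" "d < b" and out: "\<And>x. x \<notin> {c..d} \<Longrightarrow> h x = 0"
    using test_function_support[OF ab h] by blast
  have cont: "continuous_on S h" for S by (rule continuous_on_test_function[OF h])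
  define \<phi> where "\<phi> x = integral {a..x} h" for x
  have left: "\<phi> x = 0" if "x < c" for x
  proof -
    have "integral {a..x} h = integral {a..x} (\<lambda>x. 0)"
      using that by (intro integral_cong out) auto
    then show ?thesis by (simp add: \<phi>_def)
  qed
  have full: "integral {a..b} h = 0"
    using z lebesgue_on_open_eq_integral[OF continuous_integrable_open[OF cont]] by simp
  have right: "\<phi> x = 0" if "d < x" for x
  proof -
    \<comment> \<open>Comparing through \<open>max x b\<close> treats points inside and beyond the
      interval together. A point \<open>x < a\<close> can also occur, when the support is empty;
      there \<open>\<phi> x\<close> is an integral over an empty set.\<close>
    have "\<phi> x = \<phi> (max x b)" if "d < x" for x
    proof (cases "a \<le> x")
      case True
      have "integral {a..x} h + integral {x..max x b} h = integral {a..max x b} h"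
        using True by (intro Henstock_Kurzweil_Integration.integral_combine integrable_continuous_real cont) auto
      moreover have "integral {x..max x b} h = integral {x..max x b} (\<lambda>x. 0)"
        using that by (intro integral_cong out) auto
      ultimately show ?thesis by (simp add: \<phi>_def)
    next
      case False
      then have "max x b = b" "\<phi> x = 0" using ab by (auto simp: \<phi>_def)
      then show ?thesis using full by (simp add: \<phi>_def)
    qed
    note A = this
    have "\<phi> (max x b) = \<phi> b"
    proof -
      have "integral {a..b} h + integral {b..max x b} h = integral {a..max x b} h"
        using ab by (intro Henstock_Kurzweil_Integration.integral_combine integrable_continuous_real cont) auto
      moreover have "integral {b..max x b} h = integral {b..max x b} (\<lambda>x. 0)"
        using cd by (intro integral_cong out) auto
      ultimately show ?thesis by (simp add: \<phi>_def)
    qed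
    then show ?thesis using A[OF that] full by (simp add: \<phi>_def)
  qed
  have der: "(\<phi> has_real_derivative h x) (at x)" for x
  proof (cases "x < c")
    case True
    have "((\<lambda>x. 0) has_real_derivative 0) (at x)" by simp
    then have "(\<phi> has_real_derivative 0) (at x)"
      by (rule has_field_derivative_transform_within_open[where S = "{..<c}"]) (use True left in auto)
    then show ?thesis using out[of x] True by simp
  next
    case False
    then have "x \<in> {a<..<x+1}" using cd by auto
    moreover have "(\<phi> has_vector_derivative h x) (at x within {a..x+1})"
      unfolding \<phi>_def using False cd by (intro integral_has_vector_derivative cont) auto
    ultimately have "(\<phi> has_vector_derivative h x) (at x)"
      by (metis at_within_Icc_at greaterThanLessThan_iff)
    then show ?thesis by (simp add: has_real_derivative_iff_has_vector_derivative)
  qed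
  have deq: "deriv \<phi> = h" using der by (auto intro: DERIV_imp_deriv)
  have "(deriv ^^ n) \<phi> differentiable (at x)" for n x
  proof (cases n)
    case 0
    then show ?thesis using der real_differentiable_def by auto
  next
    case (Suc m)
    have "(deriv ^^ Suc m) \<phi> = (deriv ^^ m) h" by (simp only: funpow_Suc_right o_apply deq)
    then show ?thesis using h Suc by (simp add: test_functions_def)
  qed
  moreover have "closure {x. \<phi> x \<noteq> 0} \<subseteq> {c..d}"
    using left right by (intro closure_minimal) (auto simp: not_less[symmetric])
  ultimately have "\<phi> \<in> test_functions a b" using cd by (force simp: test_functions_def)
  with deq show ?thesis by blast
qed

lemma L2_test_integrable:
  fixes u :: "real \<Rightarrow> complex"
  assumes "u \<in> L2 {a<..<b}" "continuous_on {a..b} \<phi>"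
  shows "integrable (lebesgue_on {a<..<b}) (\<lambda>x. u x * complex_of_real (\<phi> x))"
  using assms L2m_integrable_mult continuous_on_L2[of a b "\<lambda>x. complex_of_real (\<phi> x)"]
  by (simp add: L2_eq_L2m continuous_on_of_real)

text \<open>The du Bois-Reymond argument. Subtracting from a test function the right multiple of a
  fixed one with nonzero integral leaves a test function of integral zero, which is the derivative
  of another. Thus \<open>u\<close> minus a suitable mean is orthogonal to every test
  function.\<close>

lemma weak_deriv_zero_imp_constant:
  assumes ab: "a < b" and u: "u \<in> L2 {a<..<b}"
    and orth: "\<And>\<phi>. \<phi> \<in> test_functions a b \<Longrightarrow>
      (LINT x|lebesgue_on {a<..<b}. u x * complex_of_real (deriv \<phi> x)) = 0"
  shows "\<exists>c. AE x in lebesgue_on {a<..<b}. u x = c"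
proof -
  let ?M = "lebesgue_on {a<..<b}"
  have cL: "(\<lambda>x. c) \<in> L2 {a<..<b}" for c :: complex by (rule continuous_on_L2) simp
  \<comment> \<open>If every test function had integral zero, the fundamental lemma would make the
    constant \<open>1\<close> vanish almost everywhere on an interval of positive length.\<close>
  have "\<exists>\<eta>\<in>test_functions a b. (LINT x|?M. \<eta> x) \<noteq> 0"
  proof (rule ccontr)
    assume "\<not> ?thesis"
    then have "AE x in ?M. (1::complex) = 0"
      by (intro fundamental_lemma_L2[where g = "\<lambda>x. 1"] cL) simp
    then have "ae_filter ?M = bot" by (simp add: eventually_False[symmetric])
    then have "emeasure ?M (space ?M) = 0" by (simp only: ae_filter_eq_bot_iff)
    then show False using ab by (simp add: emeasure_restrict_space)
  qed
  then obtain \<eta> where \<eta>: "\<eta> \<in> test_functions a b" and \<eta>0: "(LINT x|?M. \<eta> x) \<noteq> 0" by blast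
  define I where "I = (LINT x|?M. \<eta> x)"
  \<comment> \<open>The mean of \<open>u\<close> with weight \<open>\<eta>\<close>; it is the only
    possible value of the constant.\<close>
  define c where "c = (LINT x|?M. u x * complex_of_real (\<eta> x)) / complex_of_real I"
  have "AE x in ?M. u x - c = 0"
  proof (rule fundamental_lemma_L2)
    show "(\<lambda>x. u x - c) \<in> L2 {a<..<b}"
      using u cL[of c] by (simp add: L2_eq_L2m L2m_diff)
    fix \<psi> assume \<psi>: "\<psi> \<in> test_functions a b"
    define r where "r = (LINT x|?M. \<psi> x) / I"
    note ct = continuous_on_test_function(1)
    have i\<psi>: "integrable ?M \<psi>" and i\<eta>: "integrable ?M \<eta>"
      by (rule continuous_integrable_open[OF ct[OF \<psi>]], rule continuous_integrable_open[OF ct[OF \<eta>]])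
    have "(LINT x|?M. \<psi> x - r * \<eta> x) = 0"
      using i\<psi> i\<eta> \<eta>0 by (simp add: r_def I_def)
    then obtain \<phi> where "\<phi> \<in> test_functions a b" and "deriv \<phi> = (\<lambda>x. \<psi> x - r * \<eta> x)"
      using test_function_antiderivative[OF ab test_functions_diff_scale[OF \<psi> \<eta>]] by blast
    with orth have "(LINT x|?M. u x * complex_of_real (\<psi> x - r * \<eta> x)) = 0" by metis
    also have "(\<lambda>x. u x * complex_of_real (\<psi> x - r * \<eta> x)) =
        (\<lambda>x. u x * complex_of_real (\<psi> x) - complex_of_real r * (u x * complex_of_real (\<eta> x)))"
      by (simp add: algebra_simps)
    also have "(LINT x|?M. u x * complex_of_real (\<psi> x) - complex_of_real r * (u x * complex_of_real (\<eta> x)))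
        = (LINT x|?M. u x * complex_of_real (\<psi> x)) - complex_of_real r * (LINT x|?M. u x * complex_of_real (\<eta> x))"
      using L2_test_integrable[OF u ct[OF \<psi>]] L2_test_integrable[OF u ct[OF \<eta>]] by simp
    also have "complex_of_real r * (LINT x|?M. u x * complex_of_real (\<eta> x)) = c * complex_of_real (LINT x|?M. \<psi> x)"
      using \<eta>0 by (simp add: r_def c_def I_def)
    finally have *: "(LINT x|?M. u x * complex_of_real (\<psi> x)) = c * complex_of_real (LINT x|?M. \<psi> x)" by simp
    have "(LINT x|?M. (u x - c) * complex_of_real (\<psi> x)) =
        (LINT x|?M. u x * complex_of_real (\<psi> x) - c * complex_of_real (\<psi> x))"
      by (simp add: algebra_simps)
    also have "\<dots> = (LINT x|?M. u x * complex_of_real (\<psi> x)) - (LINT x|?M. c * complex_of_real (\<psi> x))"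
      by (intro Bochner_Integration.integral_diff L2_test_integrable u ct[OF \<psi>] cL)
    also have "\<dots> = 0" using * by simp
    finally show "(LINT x|?M. (u x - c) * complex_of_real (\<psi> x)) = 0" .
  qed
  then show ?thesis by (intro exI[of _ c]) auto
qed

lemma weak_deriv_unique:
  assumes "g \<in> L2 {a<..<b}" "h \<in> L2 {a<..<b}" "is_weak_deriv a b y g" "is_weak_deriv a b y h"
  shows "AE x in lebesgue_on {a<..<b}. g x = h x"
proof -
  let ?M = "lebesgue_on {a<..<b}"
  have "AE x in ?M. g x - h x = 0"
  proof (rule fundamental_lemma_L2)
    show "(\<lambda>x. g x - h x) \<in> L2 {a<..<b}" using assms by (simp add: L2_eq_L2m L2m_diff)
    fix \<phi> assume \<phi>: "\<phi> \<in> test_functions a b"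
    have "(LINT x|?M. (g x - h x) * complex_of_real (\<phi> x)) =
      (LINT x|?M. g x * complex_of_real (\<phi> x) - h x * complex_of_real (\<phi> x))"
      by (simp add: algebra_simps)
    also have "\<dots> = (LINT x|?M. g x * complex_of_real (\<phi> x)) - (LINT x|?M. h x * complex_of_real (\<phi> x))"
      by (intro Bochner_Integration.integral_diff L2_test_integrable assms continuous_on_test_function[OF \<phi>])
    also have "\<dots> = 0"
      using assms(3,4)[unfolded is_weak_deriv_def, rule_format, OF \<phi>] by simp
    finally show "(LINT x|?M. (g x - h x) * complex_of_real (\<phi> x)) = 0" .
  qed
  then show ?thesis by eventually_elim simp
qed

section \<open>Primitives of square integrable functions\<close>

text \<open>Absolute continuity with a square integrable derivative, in integrated form. The values
  of \<open>Y\<close> on the closed interval are exact, while \<open>g\<close> matters only up to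
  null sets.\<close>

definition is_primitive :: "real \<Rightarrow> real \<Rightarrow> (real \<Rightarrow> complex) \<Rightarrow> (real \<Rightarrow> complex) \<Rightarrow> bool" where
  "is_primitive a b Y g \<longleftrightarrow> g \<in> L2 {a<..<b} \<and> (\<forall>x\<in>{a..b}. Y x = Y a + integral {a..x} g)"

lemma L2_subinterval:
  fixes g :: "real \<Rightarrow> complex"
  assumes "g \<in> L2 {a<..<b}" "a \<le> c" "d \<le> b"
  shows "g \<in> L2 {c<..<d}"
  by (rule L2_subset[OF assms(1)]) (use assms in auto)

lemma L2_integrable:
  fixes g :: "real \<Rightarrow> complex"
  assumes "g \<in> L2 {a<..<b}" shows "integrable (lebesgue_on {a<..<b}) g"
  using L2m_integrable[OF finite_measure_lebesgue_on_interval(1)] assms by (simp add: L2_eq_L2m)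

lemma L2_integral_eq:
  fixes g :: "real \<Rightarrow> complex"
  assumes "g \<in> L2 {a<..<b}" shows "integral {a..b} g = (LINT x|lebesgue_on {a<..<b}. g x)"
  using lebesgue_on_open_eq_integral[OF L2_integrable[OF assms]] by simp

lemma L2_integrable_on:
  fixes g :: "real \<Rightarrow> complex"
  assumes "g \<in> L2 {a<..<b}" shows "g integrable_on {a..b}"
  using integrable_on_lebesgue_on[OF L2_integrable[OF assms]] by (simp add: integrable_on_Icc_iff_Ioo)

lemma is_primitive_continuous: "is_primitive a b Y g \<Longrightarrow> continuous_on {a..b} Y"
proof -
  assume Y: "is_primitive a b Y g"
  then have g: "g \<in> L2 {a<..<b}" and eq: "\<And>x. x \<in> {a..b} \<Longrightarrow> Y x = Y a + integral {a..x} g"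
    unfolding is_primitive_def by blast+
  have "continuous_on {a..b} (\<lambda>x. Y a + integral {a..x} g)"
    by (intro continuous_intros indefinite_integral_continuous_1 L2_integrable_on g)
  then show "continuous_on {a..b} Y" by (rule continuous_on_eq) (rule eq[symmetric])
qed

lemma is_primitive_subinterval: "is_primitive a b Y g \<Longrightarrow> c \<le> b \<Longrightarrow> is_primitive a c Y g"
proof -
  assume Y: "is_primitive a b Y g" and c: "c \<le> b"
  have "g \<in> L2 {a<..<c}"
    using Y L2_subinterval[of g a b a c] c by (simp only: is_primitive_def order_refl)
  moreover have "{a..c} \<subseteq> {a..b}" using c by simp
  ultimately show "is_primitive a c Y g" using Y unfolding is_primitive_def by blast
qed

lemma L2_sq_integral_mono:
  fixes g :: "real \<Rightarrow> complex"
  assumes g: "g \<in> L2 {a<..<b}" and "a \<le> c" "d \<le> b"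
  shows "(LINT t|lebesgue_on {c<..<d}. (cmod (g t))\<^sup>2) \<le> (LINT t|lebesgue_on {a<..<b}. (cmod (g t))\<^sup>2)"
proof -
  have i: "integrable (lebesgue_on {a<..<b}) (\<lambda>t. (cmod (g t))\<^sup>2)" using g by (simp add: L2_def)
  have j: "integrable (lebesgue_on {c<..<d}) (\<lambda>t. (cmod (g t))\<^sup>2)"
    using L2_subinterval[OF assms] by (simp add: L2_def)
  show ?thesis
  proof (cases "c < d")
    case True
    then show ?thesis
      unfolding lebesgue_on_open_eq_integral[OF i] lebesgue_on_open_eq_integral[OF j]
      using integrable_on_lebesgue_on[OF i] integrable_on_lebesgue_on[OF j] assms
      by (intro integral_subset_le) (simp_all add: integrable_on_Icc_iff_Ioo)
  next
    case False
    then have "(LINT t|lebesgue_on {c<..<d}. (cmod (g t))\<^sup>2) = 0"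
      by (intro integral_eq_zero_AE AE_I2) simp
    then show ?thesis by simp
  qed
qed

text \<open>Cauchy-Schwarz against the constant \<open>1\<close>. It turns convergence of
  derivatives in the mean into uniform convergence of primitives.\<close>

lemma L2_integral_diff_le:
  fixes g h :: "real \<Rightarrow> complex"
  assumes "g \<in> L2 {a<..<b}" "h \<in> L2 {a<..<b}" "x \<in> {a..b}"
  shows "cmod (integral {a..x} g - integral {a..x} h) \<le>
    sqrt (b - a) * sqrt (LINT t|lebesgue_on {a<..<b}. (cmod (g t - h t))\<^sup>2)"
proof -
  let ?M = "lebesgue_on {a<..<b}" and ?N = "lebesgue_on {a<..<x}"
  have d: "(\<lambda>t. g t - h t) \<in> L2 {a<..<b}" using assms by (simp add: L2_eq_L2m L2m_diff)
  have dx: "(\<lambda>t. g t - h t) \<in> L2 {a<..<x}" by (rule L2_subinterval[OF d]) (use assms in auto)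
  have gx: "g \<in> L2 {a<..<x}" by (rule L2_subinterval[OF assms(1)]) (use assms in auto)
  have hx: "h \<in> L2 {a<..<x}" by (rule L2_subinterval[OF assms(2)]) (use assms in auto)
  have "integral {a..x} g - integral {a..x} h = (LINT t|?N. 1 * (g t - h t))"
    using L2_integrable[OF gx] L2_integrable[OF hx]
    by (simp add: L2_integral_eq gx hx)
  also have "cmod \<dots> \<le> sqrt (LINT t|?N. (cmod 1)\<^sup>2) * sqrt (LINT t|?N. (cmod (g t - h t))\<^sup>2)"
    by (rule L2m_norm_integral_mult_le) (use dx continuous_on_L2[of a x "\<lambda>t. 1"] in \<open>simp_all add: L2_eq_L2m\<close>)
  also have "\<dots> \<le> sqrt (b - a) * sqrt (LINT t|?M. (cmod (g t - h t))\<^sup>2)"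
  proof (intro mult_mono real_sqrt_le_mono)
    show "(LINT t|?N. (cmod 1)\<^sup>2) \<le> b - a"
      using assms(3) by (simp add: measure_restrict_space)
    show "(LINT t|?N. (cmod (g t - h t))\<^sup>2) \<le> (LINT t|?M. (cmod (g t - h t))\<^sup>2)"
      using assms(3) by (intro L2_sq_integral_mono[OF d]) auto
  qed (use assms in auto)
  finally show ?thesis .
qed

section \<open>Approximation of primitives by exponential sums\<close>

text \<open>The entire extension of \<open>expsum\<close>; the complex rules of differentiation
  apply to it, and the derivative along the real line is then a restriction.\<close>

definition cexpsum :: "(nat \<Rightarrow> complex) \<Rightarrow> nat \<Rightarrow> complex \<Rightarrow> complex" where
  "cexpsum c n z = (\<Sum>k\<le>n. c k * exp (of_nat k * z))"

lemma expsum_eq_cexpsum: "expsum c n t = cexpsum c n (complex_of_real t)"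
  by (simp add: expsum_def cexpsum_def)

lemma cexpsum_has_derivative:
  "(cexpsum c n has_field_derivative cexpsum (\<lambda>k. of_nat k * c k) n z) (at z)"
  unfolding cexpsum_def
  by (rule DERIV_sum) (auto intro!: derivative_eq_intros)

lemma expsum_has_derivative:
  "(expsum c n has_vector_derivative expsum (\<lambda>k. of_nat k * c k) n t) (at t within S)"
  unfolding expsum_eq_cexpsum[abs_def]
  by (rule has_vector_derivative_real_field[OF cexpsum_has_derivative])

text \<open>The derivative is approximated in the mean by sums without constant term, which are
  integrated termwise by dividing each coefficient by its exponent. The free coefficient at exponent
  \<open>0\<close> is used to reproduce the value of \<open>Y\<close> at \<open>a\<close> exactly,
  so the uniform error comes from the derivatives alone.\<close>

lemma is_primitive_approx:
  assumes Y: "is_primitive a b Y g" and ab: "a \<le> b"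
  shows "\<exists>c N. uniform_limit {a..b} (\<lambda>n. expsum (c n) (N n)) Y sequentially \<and>
    (\<lambda>n. LINT t|lebesgue_on {a<..<b}. (cmod (expsum (\<lambda>k. of_nat k * c n k) (N n) t - g t))\<^sup>2) \<longlonglongrightarrow> 0"
proof -
  let ?M = "lebesgue_on {a<..<b}"
  have g: "g \<in> L2 {a<..<b}" using Y by (simp add: is_primitive_def)
  obtain e where "\<exists>N. (\<forall>n. e n 0 = 0) \<and>
    (\<lambda>n. LINT t|?M. (cmod (expsum (e n) (N n) t - g t))\<^sup>2) \<longlonglongrightarrow> 0"
    using L2_expsum_sequence[OF g] by (rule exE)
  then obtain N where "(\<forall>n. e n 0 = 0) \<and>
    (\<lambda>n. LINT t|?M. (cmod (expsum (e n) (N n) t - g t))\<^sup>2) \<longlonglongrightarrow> 0"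
    by (rule exE)
  then have e0: "\<And>n. e n 0 = 0" and
    lim: "(\<lambda>n. LINT t|?M. (cmod (expsum (e n) (N n) t - g t))\<^sup>2) \<longlonglongrightarrow> 0" by simp_all
  \<comment> \<open>The value at \<open>a\<close> of the integrated sum before its constant term is
    fixed.\<close>
  define r where "r n = (\<Sum>k\<in>{1..N n}. e n k / of_nat k * exp (of_nat k * complex_of_real a))" for n
  define c where "c n k = (if k = 0 then Y a - r n else e n k / of_nat k)" for n k
  \<comment> \<open>At \<open>k = 0\<close> both sides vanish only because the approximating sums
    have no constant term.\<close>
  have ce: "of_nat k * c n k = e n k" for n k by (simp add: c_def e0)
  have ca: "expsum (c n) (N n) a = Y a" for n
  proof -
    have "{..N n} = insert 0 {1..N n}" by auto
    then show ?thesis by (simp add: expsum_def c_def r_def)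
  qed
  have eL: "expsum (e n) (N n) \<in> L2 {a<..<b}" for n
    by (rule continuous_on_L2[OF continuous_on_expsum])
  have bound: "dist (expsum (c n) (N n) x) (Y x) \<le>
      sqrt (b - a) * sqrt (LINT t|?M. (cmod (expsum (e n) (N n) t - g t))\<^sup>2)" if x: "x \<in> {a..b}" for n x
  proof -
    have "(expsum (e n) (N n) has_integral (expsum (c n) (N n) x - expsum (c n) (N n) a)) {a..x}"
      using x expsum_has_derivative[of "c n" "N n"] by (intro fundamental_theorem_of_calculus) (auto simp: ce)
    then have "expsum (c n) (N n) x = Y a + integral {a..x} (expsum (e n) (N n))"
      by (simp add: integral_unique ca)
    moreover have "Y x = Y a + integral {a..x} g" using Y x unfolding is_primitive_def by blast
    ultimately show ?thesis using L2_integral_diff_le[OF eL[of n] g x] by (simp add: dist_norm)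
  qed
  have lim': "(\<lambda>n. sqrt (b - a) * sqrt (LINT t|?M. (cmod (expsum (e n) (N n) t - g t))\<^sup>2)) \<longlonglongrightarrow> 0"
    using tendsto_mult[OF tendsto_const tendsto_real_sqrt[OF lim], of "sqrt (b - a)"] by simp
  have "uniform_limit {a..b} (\<lambda>n. expsum (c n) (N n)) Y sequentially"
  proof (rule uniform_limitI)
    fix d :: real assume "0 < d"
    then have "\<forall>\<^sub>F n in sequentially. sqrt (b - a) * sqrt (LINT t|?M. (cmod (expsum (e n) (N n) t - g t))\<^sup>2) < d"
      by (rule order_tendstoD(2)[OF lim'])
    then show "\<forall>\<^sub>F n in sequentially. \<forall>x\<in>{a..b}. dist (expsum (c n) (N n) x) (Y x) < d"
      by eventually_elim (use bound in \<open>blast intro: le_less_trans\<close>)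
  qed
  then show ?thesis using lim by (intro exI[of _ c] exI[of _ N]) (simp add: ce)
qed

lemma uniform_limit_L2:
  fixes w :: "real \<Rightarrow> complex"
  assumes u: "uniform_limit {a..b} wn w sequentially"
    and w: "w \<in> L2 {a<..<b}" and wn: "\<And>n. wn n \<in> L2 {a<..<b}"
  shows "(\<lambda>n. LINT t|lebesgue_on {a<..<b}. (cmod (wn n t - w t))\<^sup>2) \<longlonglongrightarrow> 0"
proof (rule tendstoI)
  let ?M = "lebesgue_on {a<..<b}"
  interpret finite_measure ?M by (rule finite_measure_lebesgue_on_interval)
  fix e :: real assume e: "0 < e"
  define m where "m = measure ?M {a<..<b}"
  have m0: "0 \<le> m" by (simp add: m_def)
  define d where "d = sqrt (e / (m + 1))"
  have d: "0 < d" using e m0 by (simp add: d_def)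
  from uniform_limitD[OF u d]
  show "\<forall>\<^sub>F n in sequentially. dist (LINT t|?M. (cmod (wn n t - w t))\<^sup>2) 0 < e"
  proof eventually_elim
    case (elim n)
    have "(LINT t|?M. (cmod (wn n t - w t))\<^sup>2) \<le> (LINT t|?M. d\<^sup>2)"
    proof (rule integral_mono)
      show "integrable ?M (\<lambda>t. (cmod (wn n t - w t))\<^sup>2)"
        using w wn by (intro L2m_integrable_sq L2m_diff) (simp_all add: L2_eq_L2m)
      fix t assume "t \<in> space ?M"
      then have "cmod (wn n t - w t) \<le> d" using elim by (auto simp: dist_norm intro: less_imp_le)
      then show "(cmod (wn n t - w t))\<^sup>2 \<le> d\<^sup>2" by (rule power_mono) simp
    qed simp
    also have "\<dots> = e * (m / (m + 1))" using e m0 by (simp add: m_def[symmetric] d_def)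
    also have "\<dots> < e * 1" using e m0 by (intro mult_strict_left_mono) auto
    finally show ?case by simp
  qed
qed

text \<open>Both factors vary. The product \<open>un * vn\<close> splits into
  \<open>(un - u) * (vn - v) + u * vn + v * un - u * v\<close>: the first term vanishes in the limit
  by Cauchy-Schwarz, the next two have one fixed factor.\<close>

lemma L2m_mult_limit:
  assumes u: "u \<in> L2m M" and v: "v \<in> L2m M"
    and un: "\<And>n. un n \<in> L2m M" and vn: "\<And>n. vn n \<in> L2m M"
    and ulim: "(\<lambda>n. LINT x|M. (cmod (un n x - u x))\<^sup>2) \<longlonglongrightarrow> 0"
    and vlim: "(\<lambda>n. LINT x|M. (cmod (vn n x - v x))\<^sup>2) \<longlonglongrightarrow> 0"
  shows "(\<lambda>n. LINT x|M. un n x * vn n x) \<longlonglongrightarrow> (LINT x|M. u x * v x)"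
proof -
  have du: "(\<lambda>x. un n x - u x) \<in> L2m M" and dv: "(\<lambda>x. vn n x - v x) \<in> L2m M" for n
    by (intro L2m_diff u v un vn)+
  note im = L2m_integrable_mult
  have eq: "(LINT x|M. un n x * vn n x) = (LINT x|M. (un n x - u x) * (vn n x - v x))
    + (LINT x|M. u x * vn n x) + (LINT x|M. v x * un n x) - (LINT x|M. u x * v x)" for n
  proof -
    have "(LINT x|M. un n x * vn n x) =
      (LINT x|M. (un n x - u x) * (vn n x - v x) + u x * vn n x + v x * un n x - u x * v x)"
      by (simp add: algebra_simps)
    then show ?thesis by (simp add: im[OF du dv] im[OF u vn] im[OF v un] im[OF u v])
  qed
  have "(\<lambda>n. LINT x|M. (un n x - u x) * (vn n x - v x)) \<longlonglongrightarrow> 0"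
  proof (rule Lim_null_comparison[OF always_eventually[OF allI]])
    show "norm (LINT x|M. (un n x - u x) * (vn n x - v x)) \<le>
      sqrt (LINT x|M. (cmod (un n x - u x))\<^sup>2) * sqrt (LINT x|M. (cmod (vn n x - v x))\<^sup>2)" for n
      by (rule L2m_norm_integral_mult_le[OF du dv])
    show "(\<lambda>n. sqrt (LINT x|M. (cmod (un n x - u x))\<^sup>2) * sqrt (LINT x|M. (cmod (vn n x - v x))\<^sup>2)) \<longlonglongrightarrow> 0"
      using tendsto_mult[OF tendsto_real_sqrt[OF ulim] tendsto_real_sqrt[OF vlim]] by simp
  qed
  from tendsto_diff[OF tendsto_add[OF tendsto_add[OF this L2m_weak_limit[OF u v vn vlim]]
      L2m_weak_limit[OF v u un ulim]] tendsto_const[of "LINT x|M. u x * v x"]]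
  show ?thesis unfolding eq by (simp add: mult.commute)
qed

text \<open>For exponential sums this is classical integration by parts with vanishing boundary
  terms. Both pairings pass to the limit: the function converges uniformly, its derivative in the
  mean.\<close>

lemma is_primitive_weak_deriv:
  assumes Y: "is_primitive a b Y g" and ab: "a \<le> b"
  shows "is_weak_deriv a b Y g"
  unfolding is_weak_deriv_def
proof
  let ?M = "lebesgue_on {a<..<b}"
  fix \<phi> assume \<phi>: "\<phi> \<in> test_functions a b"
  have g: "g \<in> L2 {a<..<b}" using Y by (simp add: is_primitive_def)
  obtain c N where ulim: "uniform_limit {a..b} (\<lambda>n. expsum (c n) (N n)) Y sequentially"
    and glim: "(\<lambda>n. LINT t|?M. (cmod (expsum (\<lambda>k. of_nat k * c n k) (N n) t - g t))\<^sup>2) \<longlonglongrightarrow> 0"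
    using is_primitive_approx[OF Y ab] by (elim exE conjE) (rule that)
  let ?Y = "\<lambda>n. expsum (c n) (N n)" and ?g = "\<lambda>n. expsum (\<lambda>k. of_nat k * c n k) (N n)"
  let ?\<phi> = "\<lambda>x. complex_of_real (\<phi> x)" and ?d = "\<lambda>x. complex_of_real (deriv \<phi> x)"
  have YL: "Y \<in> L2 {a<..<b}" by (rule continuous_on_L2[OF is_primitive_continuous[OF Y]])
  have YnL: "?Y n \<in> L2 {a<..<b}" and gnL: "?g n \<in> L2 {a<..<b}" for n
    by (rule continuous_on_L2[OF continuous_on_expsum])+
  have c\<phi>: "continuous_on S ?\<phi>" and cd: "continuous_on S ?d" for S
    by (intro continuous_on_of_real continuous_on_test_function[OF \<phi>])+
  have \<phi>L: "?\<phi> \<in> L2 {a<..<b}" and dL: "?d \<in> L2 {a<..<b}"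
    by (rule continuous_on_L2[OF c\<phi>], rule continuous_on_L2[OF cd])
  have ibp: "(LINT x|?M. ?d x * ?Y n x) = - (LINT x|?M. ?\<phi> x * ?g n x)" for n
  proof -
    have "((\<lambda>x. ?d x * ?Y n x + ?\<phi> x * ?g n x) has_integral (?\<phi> b * ?Y n b - ?\<phi> a * ?Y n a)) {a..b}"
    proof (rule fundamental_theorem_of_calculus[OF ab])
      fix x
      have "(\<phi> has_vector_derivative deriv \<phi> x) (at x within {a..b})"
        using has_field_derivative_at_within[OF test_function_has_derivative[OF \<phi>]]
        by (simp add: has_real_derivative_iff_has_vector_derivative)
      then have "(?\<phi> has_vector_derivative ?d x) (at x within {a..b})"
        by (rule bounded_linear.has_vector_derivative[OF bounded_linear_of_real])
      from has_vector_derivative_mult[OF this expsum_has_derivative[of "c n" "N n" x "{a..b}"]]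
      show "((\<lambda>x. ?\<phi> x * ?Y n x) has_vector_derivative ?d x * ?Y n x + ?\<phi> x * ?g n x) (at x within {a..b})"
        by (simp add: add.commute)
    qed
    moreover have "\<phi> a = 0" "\<phi> b = 0" using test_function_outside[OF \<phi>] by auto
    ultimately have "integral {a..b} (\<lambda>x. ?d x * ?Y n x + ?\<phi> x * ?g n x) = 0"
      by (simp add: integral_unique)
    moreover have "integrable ?M (\<lambda>x. ?d x * ?Y n x)" and "integrable ?M (\<lambda>x. ?\<phi> x * ?g n x)"
      using \<phi>L dL YnL gnL by (auto intro: L2m_integrable_mult simp: L2_eq_L2m)
    ultimately show ?thesis
      using lebesgue_on_open_eq_integral[of a b "\<lambda>x. ?d x * ?Y n x + ?\<phi> x * ?g n x"]
      by (simp add: eq_neg_iff_add_eq_0)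
  qed
  have "(\<lambda>n. LINT x|?M. ?d x * ?Y n x) \<longlonglongrightarrow> (LINT x|?M. ?d x * Y x)"
    using dL YL YnL uniform_limit_L2[OF ulim YL YnL] by (intro L2m_weak_limit) (simp_all add: L2_eq_L2m)
  moreover have "(\<lambda>n. - (LINT x|?M. ?\<phi> x * ?g n x)) \<longlonglongrightarrow> - (LINT x|?M. ?\<phi> x * g x)"
    using \<phi>L g gnL glim by (intro tendsto_minus L2m_weak_limit) (simp_all add: L2_eq_L2m)
  ultimately have "(LINT x|?M. ?d x * Y x) = - (LINT x|?M. ?\<phi> x * g x)"
    unfolding ibp by (rule LIMSEQ_unique)
  then show "(LINT x|?M. Y x * ?d x) = - (LINT x|?M. g x * ?\<phi> x)" by (simp add: mult.commute)
qed

text \<open>The difference between \<open>y\<close> and the indefinite integral of \<open>g\<close>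
  has weak derivative zero, hence is constant almost everywhere.\<close>

lemma weak_deriv_imp_primitive:
  assumes ab: "a < b" and y: "y \<in> L2 {a<..<b}" and g: "g \<in> L2 {a<..<b}"
    and wd: "is_weak_deriv a b y g"
  shows "\<exists>Y. is_primitive a b Y g \<and> (AE x in lebesgue_on {a<..<b}. Y x = y x)"
proof -
  let ?M = "lebesgue_on {a<..<b}"
  define G where "G x = integral {a..x} g" for x
  have G: "is_primitive a b G g" using g by (simp add: is_primitive_def G_def)
  have GL: "G \<in> L2 {a<..<b}" by (rule continuous_on_L2[OF is_primitive_continuous[OF G]])
  have wG: "is_weak_deriv a b G g" by (rule is_primitive_weak_deriv[OF G]) (use ab in simp)
  have "\<exists>c. AE x in ?M. y x - G x = c"
  proof (rule weak_deriv_zero_imp_constant[OF ab])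
    show "(\<lambda>x. y x - G x) \<in> L2 {a<..<b}" using y GL by (simp add: L2_eq_L2m L2m_diff)
    fix \<phi> assume \<phi>: "\<phi> \<in> test_functions a b"
    let ?d = "\<lambda>x. complex_of_real (deriv \<phi> x)"
    have "(LINT x|?M. (y x - G x) * ?d x) = (LINT x|?M. y x * ?d x - G x * ?d x)"
      by (simp add: algebra_simps)
    also have "\<dots> = (LINT x|?M. y x * ?d x) - (LINT x|?M. G x * ?d x)"
      by (intro Bochner_Integration.integral_diff L2_test_integrable y GL continuous_on_test_function[OF \<phi>])
    also have "\<dots> = 0"
      using wd[unfolded is_weak_deriv_def, rule_format, OF \<phi>] wG[unfolded is_weak_deriv_def, rule_format, OF \<phi>]
      by simp
    finally show "(LINT x|?M. (y x - G x) * ?d x) = 0" .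
  qed
  then obtain c where c: "AE x in ?M. y x - G x = c" by blast
  have "is_primitive a b (\<lambda>x. c + G x) g" using g by (simp add: is_primitive_def G_def)
  moreover have "AE x in ?M. c + G x = y x" using c by eventually_elim auto
  ultimately show ?thesis by (intro exI[of _ "\<lambda>x. c + G x"]) simp
qed

lemma is_primitive_approx_C1:
  assumes "is_primitive a b Y g" "a \<le> b"
  shows "\<exists>Yn gn. (\<forall>n. continuous_on UNIV (Yn n) \<and> continuous_on UNIV (gn n) \<and>
      (\<forall>x S. (Yn n has_vector_derivative gn n x) (at x within S))) \<and>
    uniform_limit {a..b} Yn Y sequentially \<and>
    (\<lambda>n. LINT t|lebesgue_on {a<..<b}. (cmod (gn n t - g t))\<^sup>2) \<longlonglongrightarrow> 0"
proof -
  obtain c where "\<exists>N. uniform_limit {a..b} (\<lambda>n. expsum (c n) (N n)) Y sequentially \<and>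
    (\<lambda>n. LINT t|lebesgue_on {a<..<b}. (cmod (expsum (\<lambda>k. of_nat k * c n k) (N n) t - g t))\<^sup>2) \<longlonglongrightarrow> 0"
    using is_primitive_approx[OF assms] by (rule exE)
  then obtain N where "uniform_limit {a..b} (\<lambda>n. expsum (c n) (N n)) Y sequentially \<and>
    (\<lambda>n. LINT t|lebesgue_on {a<..<b}. (cmod (expsum (\<lambda>k. of_nat k * c n k) (N n) t - g t))\<^sup>2) \<longlonglongrightarrow> 0"
    by (rule exE)
  then show ?thesis
    by (intro exI[of _ "\<lambda>n. expsum (c n) (N n)"] exI[of _ "\<lambda>n. expsum (\<lambda>k. of_nat k * c n k) (N n)"])
      (simp add: continuous_on_expsum expsum_has_derivative)
qed

section \<open>The quotient rule for primitives\<close>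

text \<open>The derivative is written as a sum of terms, each a derivative times a continuous
  factor. This is the shape in which the factors converge separately, the former in the mean and the
  latter uniformly.\<close>

lemma has_vector_derivative_quotient:
  fixes p q :: "real \<Rightarrow> complex"
  assumes "(p has_vector_derivative p') (at x within S)" "(q has_vector_derivative q') (at x within S)"
    and "q x \<noteq> 0"
  shows "((\<lambda>x. p x / q x) has_vector_derivative
    p' * inverse (q x) - q' * (p x * (inverse (q x) * inverse (q x)))) (at x within S)"
proof -
  have "((\<lambda>x. p x / q x) has_derivative
      (\<lambda>h. ((h *\<^sub>R p') * q x - p x * (h *\<^sub>R q')) / (q x * q x))) (at x within S)"
    using assms by (intro has_derivative_divide') (simp_all add: has_vector_derivative_def)
  moreover have "((h *\<^sub>R p') * q x - p x * (h *\<^sub>R q')) / (q x * q x) =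
      h *\<^sub>R (p' * inverse (q x) - q' * (p x * (inverse (q x) * inverse (q x))))" for h
    using assms(3) by (simp add: scaleR_conv_of_real field_simps)
  ultimately show ?thesis by (simp add: has_vector_derivative_def)
qed

lemma bounded_image_continuous:
  fixes u :: "real \<Rightarrow> complex"
  shows "continuous_on {a..b} u \<Longrightarrow> bounded (u ` {a..b})"
  using compact_continuous_image compact_imp_bounded by blast

lemma continuous_nonzero_lower_bound:
  fixes q :: "real \<Rightarrow> complex"
  assumes "continuous_on {a..b} q" "\<And>x. x \<in> {a..b} \<Longrightarrow> q x \<noteq> 0" "a \<le> b"
  shows "\<exists>m>0. \<forall>x\<in>{a..b}. m \<le> cmod (q x)"
proof -
  have "\<exists>x\<in>{a..b}. \<forall>y\<in>{a..b}. cmod (q x) \<le> cmod (q y)"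
    using assms by (intro continuous_attains_inf continuous_on_norm) auto
  then obtain x where "x \<in> {a..b}" "\<forall>y\<in>{a..b}. cmod (q x) \<le> cmod (q y)" by blast
  then show ?thesis using assms(2) by (intro exI[of _ "cmod (q x)"]) auto
qed

text \<open>The classical quotient rule is integrated for smooth approximants of \<open>p\<close>
  and \<open>q\<close> and passed to the limit. Stating it for the end point suffices, since it can
  be applied on every initial subinterval.\<close>

lemma is_primitive_quotient_end:
  assumes p: "is_primitive a b p p'" and q: "is_primitive a b q q'" and ab: "a \<le> b"
    and nz: "\<And>x. x \<in> {a..b} \<Longrightarrow> q x \<noteq> 0"
  shows "p b / q b = p a / q a +
    integral {a..b} (\<lambda>x. p' x * inverse (q x) - q' x * (p x * (inverse (q x) * inverse (q x))))"
proof -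
  let ?M = "lebesgue_on {a<..<b}"
  note cp = is_primitive_continuous[OF p] and cq = is_primitive_continuous[OF q]
  have p'L: "p' \<in> L2 {a<..<b}" and q'L: "q' \<in> L2 {a<..<b}" using p q unfolding is_primitive_def by blast+
  obtain m where m: "0 < m" "\<And>x. x \<in> {a..b} \<Longrightarrow> m \<le> cmod (q x)"
    using continuous_nonzero_lower_bound[OF cq nz ab] by blast
  obtain pn pn' where pc: "\<And>n S. continuous_on S (pn n)" and pc': "\<And>n S. continuous_on S (pn' n)"
    and pd: "\<And>n x S. (pn n has_vector_derivative pn' n x) (at x within S)"
    and pu: "uniform_limit {a..b} pn p sequentially"
    and pl: "(\<lambda>n. LINT t|?M. (cmod (pn' n t - p' t))\<^sup>2) \<longlonglongrightarrow> 0"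
    using is_primitive_approx_C1[OF p ab] continuous_on_subset[OF _ subset_UNIV] by blast
  obtain qn qn' where qc: "\<And>n S. continuous_on S (qn n)" and qc': "\<And>n S. continuous_on S (qn' n)"
    and qd: "\<And>n x S. (qn n has_vector_derivative qn' n x) (at x within S)"
    and qu: "uniform_limit {a..b} qn q sequentially"
    and ql: "(\<lambda>n. LINT t|?M. (cmod (qn' n t - q' t))\<^sup>2) \<longlonglongrightarrow> 0"
    using is_primitive_approx_C1[OF q ab] continuous_on_subset[OF _ subset_UNIV] by blast
  \<comment> \<open>From index \<open>k\<close> on the approximants of \<open>q\<close> differ from
    it by less than the lower bound \<open>m\<close> of its modulus, so they have no zeros. The
    sequences are shifted by \<open>k\<close> from here on.\<close>
  obtain k where k: "\<And>n x. n \<ge> k \<Longrightarrow> x \<in> {a..b} \<Longrightarrow> dist (qn n x) (q x) < m"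
    using uniform_limitD[OF qu m(1)] unfolding eventually_sequentially by blast
  have qnz: "qn (n + k) x \<noteq> 0" if "x \<in> {a..b}" for n x
    using k[of "n + k" x] m(2)[OF that] that by (auto simp: dist_norm)
  note sh = filterlim_add_const_nat_at_top[of k]
  define r rn where "r x = inverse (q x)" and "rn n x = inverse (qn (n + k) x)" for n x
  define s sn where "s x = p x * (r x * r x)" and "sn n x = pn (n + k) x * (rn n x * rn n x)" for n x
  have cr: "continuous_on {a..b} r" unfolding r_def using nz by (intro continuous_intros cq) auto
  have crn: "continuous_on {a..b} (rn n)" for n unfolding rn_def using qnz by (intro continuous_intros qc) auto
  have cs: "continuous_on {a..b} s" unfolding s_def by (intro continuous_intros cp cr)
  have csn: "continuous_on {a..b} (sn n)" for n unfolding sn_def by (intro continuous_intros pc crn)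
  have ur: "uniform_limit {a..b} rn r sequentially"
    using uniform_lim_inverse[OF filterlim_compose[OF qu sh] m(2) m(1)]
    by (simp add: r_def[abs_def] rn_def[abs_def] o_def)
  have us: "uniform_limit {a..b} sn s sequentially"
    unfolding s_def[abs_def] sn_def[abs_def]
    by (intro uniform_lim_mult filterlim_compose[OF pu sh] ur bounded_image_continuous cp cr continuous_on_mult)
  have rL: "(\<lambda>n. LINT t|?M. (cmod (rn n t - r t))\<^sup>2) \<longlonglongrightarrow> 0"
    by (intro uniform_limit_L2 ur continuous_on_L2 cr crn)
  have sL: "(\<lambda>n. LINT t|?M. (cmod (sn n t - s t))\<^sup>2) \<longlonglongrightarrow> 0"
    by (intro uniform_limit_L2 us continuous_on_L2 cs csn)
  have L: "u \<in> L2m ?M" if "continuous_on {a..b} u" for u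
    using continuous_on_L2[OF that] by (simp add: L2_eq_L2m)
  have p'L2: "p' \<in> L2m ?M" and q'L2: "q' \<in> L2m ?M" using p'L q'L by (simp_all add: L2_eq_L2m)
  have eq: "pn (n + k) b / qn (n + k) b - pn (n + k) a / qn (n + k) a =
      (LINT t|?M. pn' (n + k) t * rn n t) - (LINT t|?M. qn' (n + k) t * sn n t)" for n
  proof -
    have "((\<lambda>t. pn' (n + k) t * rn n t - qn' (n + k) t * sn n t) has_integral
        (pn (n + k) b / qn (n + k) b - pn (n + k) a / qn (n + k) a)) {a..b}"
      unfolding rn_def sn_def
      by (intro fundamental_theorem_of_calculus[OF ab] has_vector_derivative_quotient pd qd qnz)
    moreover have "integrable ?M (\<lambda>t. pn' (n + k) t * rn n t)" and "integrable ?M (\<lambda>t. qn' (n + k) t * sn n t)"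
      by (intro L2m_integrable_mult L pc' qc' crn csn)+
    ultimately show ?thesis
      using lebesgue_on_open_eq_integral[of a b "\<lambda>t. pn' (n + k) t * rn n t - qn' (n + k) t * sn n t"]
      by (simp add: integral_unique)
  qed
  have "(\<lambda>n. (LINT t|?M. pn' (n + k) t * rn n t) - (LINT t|?M. qn' (n + k) t * sn n t)) \<longlonglongrightarrow>
      (LINT t|?M. p' t * r t) - (LINT t|?M. q' t * s t)"
    by (intro tendsto_diff L2m_mult_limit p'L2 q'L2 L cr cs crn csn pc' qc' rL sL
        filterlim_compose[OF pl sh] filterlim_compose[OF ql sh])
  moreover have "(\<lambda>n. pn (n + k) b / qn (n + k) b - pn (n + k) a / qn (n + k) a) \<longlonglongrightarrow> p b / q b - p a / q a"
    using ab nz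
    by (intro tendsto_intros filterlim_compose[OF tendsto_uniform_limitI[OF pu] sh]
        filterlim_compose[OF tendsto_uniform_limitI[OF qu] sh]) auto
  ultimately have "p b / q b - p a / q a = (LINT t|?M. p' t * r t) - (LINT t|?M. q' t * s t)"
    unfolding eq using LIMSEQ_unique by blast
  also have "\<dots> = (LINT t|?M. p' t * r t - q' t * s t)"
    by (intro Bochner_Integration.integral_diff[symmetric] L2m_integrable_mult p'L2 q'L2 L cr cs)
  also have "\<dots> = integral {a..b} (\<lambda>t. p' t * r t - q' t * s t)"
    by (intro lebesgue_on_open_eq_integral Bochner_Integration.integrable_diff L2m_integrable_mult p'L2 q'L2 L cr cs)
  finally show ?thesis by (simp add: r_def s_def algebra_simps)
qed

lemma is_primitive_quotient:
  assumes p: "is_primitive a b p p'" and q: "is_primitive a b q q'"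
    and nz: "\<And>x. x \<in> {a..b} \<Longrightarrow> q x \<noteq> 0"
  shows "\<exists>h. is_primitive a b (\<lambda>x. p x / q x) h"
proof -
  let ?h = "\<lambda>x. inverse (q x) * p' x - (p x * (inverse (q x) * inverse (q x))) * q' x"
  note cp = is_primitive_continuous[OF p] and cq = is_primitive_continuous[OF q]
  have p'L: "p' \<in> L2 {a<..<b}" and q'L: "q' \<in> L2 {a<..<b}" using p q unfolding is_primitive_def by blast+
  have "?h \<in> L2 {a<..<b}"
    using L2_mult_continuous[OF _ p'L, of "\<lambda>x. inverse (q x)"]
      L2_mult_continuous[OF _ q'L, of "\<lambda>x. p x * (inverse (q x) * inverse (q x))"] nz
    by (simp add: L2_eq_L2m L2m_diff continuous_on_mult continuous_on_inverse cp cq)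
  moreover have "p x / q x = p a / q a + integral {a..x} ?h" if x: "x \<in> {a..b}" for x
    using is_primitive_quotient_end[OF is_primitive_subinterval[OF p, of x] is_primitive_subinterval[OF q, of x]]
      x nz by (simp add: mult.commute)
  ultimately show ?thesis unfolding is_primitive_def by blast
qed

section \<open>Continuous representatives of Sobolev functions\<close>

text \<open>A continuous nonnegative function with integral zero vanishes everywhere, end points
  included. This is what gives boundary values of a Sobolev function a meaning.\<close>

lemma continuous_AE_eq:
  fixes u v :: "real \<Rightarrow> complex"
  assumes ab: "a < b" and u: "continuous_on {a..b} u" and v: "continuous_on {a..b} v"
    and ae: "AE x in lebesgue_on {a<..<b}. u x = v x" and x: "x \<in> {a..b}"
  shows "u x = v x"
proof -
  let ?w = "\<lambda>x. cmod (u x - v x)"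
  have c: "continuous_on {a..b} ?w" by (intro continuous_intros u v)
  have "(LINT x|lebesgue_on {a<..<b}. ?w x) = 0"
    using ae by (intro integral_eq_zero_AE) auto
  then have "integral {a..b} ?w = 0"
    using lebesgue_on_open_eq_integral[OF continuous_integrable_open[OF c]] by simp
  then have "(?w has_integral 0) (cbox a b)"
    using integrable_integral[OF integrable_continuous_real[OF c]] by simp
  from has_integral_0_cbox_imp_0[OF _ _ this, of x] have "?w x = 0" using c ab x by simp
  then show ?thesis by simp
qed

lemma AE_lebesgue_on_subset:
  assumes "AE x in lebesgue_on A. P x" "B \<subseteq> A" "A \<in> sets lebesgue" "B \<in> sets lebesgue"
  shows "AE x in lebesgue_on B. P x"
  using assms by (auto simp: AE_restrict_space_iff elim!: eventually_mono)

lemma L2_integral_cong_AE: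
  fixes g h :: "real \<Rightarrow> complex"
  assumes g: "g \<in> L2 {a<..<b}" and h: "h \<in> L2 {a<..<b}"
    and ae: "AE x in lebesgue_on {a<..<b}. g x = h x" and x: "x \<le> b"
  shows "integral {a..x} g = integral {a..x} h"
proof -
  have "AE x in lebesgue_on {a<..<x}. g x = h x"
    using x by (intro AE_lebesgue_on_subset[OF ae]) auto
  moreover have gx: "g \<in> L2 {a<..<x}" and hx: "h \<in> L2 {a<..<x}"
    using x L2_subinterval[OF g] L2_subinterval[OF h] by auto
  ultimately show ?thesis unfolding L2_integral_eq[OF gx] L2_integral_eq[OF hx]
    by (intro integral_cong_AE) (auto simp: L2_def)
qed

lemma is_primitive_cong:
  assumes Y: "is_primitive a b Y g" and eq: "\<And>x. x \<in> {a..b} \<Longrightarrow> Y x = Z x"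
    and h: "h \<in> borel_measurable (lebesgue_on {a<..<b})"
    and ae: "AE x in lebesgue_on {a<..<b}. g x = h x"
  shows "is_primitive a b Z h"
proof -
  have g: "g \<in> L2 {a<..<b}" and Yeq: "\<And>x. x \<in> {a..b} \<Longrightarrow> Y x = Y a + integral {a..x} g"
    using Y unfolding is_primitive_def by blast+
  have hL: "h \<in> L2 {a<..<b}" using L2m_cong_AE[OF g[unfolded L2_eq_L2m] h ae] by (simp add: L2_eq_L2m)
  have "Z x = Z a + integral {a..x} h" if x: "x \<in> {a..b}" for x
    using Yeq[OF x] eq[OF x] eq[of a] x L2_integral_cong_AE[OF g hL ae, of x] by simp
  then show ?thesis using hL unfolding is_primitive_def by blast
qed

lemma W12_weak_deriv:
  assumes "y \<in> W12 a b"
  shows "weak_deriv a b y \<in> L2 {a<..<b}" "is_weak_deriv a b y (weak_deriv a b y)"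
proof -
  have "\<exists>g. g \<in> L2 {a<..<b} \<and> is_weak_deriv a b y g" using assms by (auto simp: W12_def)
  from someI_ex[OF this]
  show "weak_deriv a b y \<in> L2 {a<..<b}" "is_weak_deriv a b y (weak_deriv a b y)"
    by (simp_all add: weak_deriv_def)
qed

lemma W12_measurable: "y \<in> W12 a b \<Longrightarrow> y \<in> borel_measurable (lebesgue_on {a<..<b})"
  by (simp add: W12_def L2_def)

lemma W12_primitive:
  assumes "a < b" "y \<in> W12 a b"
  shows "\<exists>Y. is_primitive a b Y (weak_deriv a b y) \<and> (AE x in lebesgue_on {a<..<b}. Y x = y x)"
  by (rule weak_deriv_imp_primitive[OF assms(1) _ W12_weak_deriv[OF assms(2)]])
    (use assms(2) in \<open>simp add: W12_def\<close>)

lemma W12_continuous_primitive: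
  assumes ab: "a < b" and y: "y \<in> W12 a b" and c: "continuous_on {a..b} Z"
    and ae: "AE x in lebesgue_on {a<..<b}. Z x = y x"
  shows "is_primitive a b Z (weak_deriv a b y)"
proof -
  obtain Y where Y: "is_primitive a b Y (weak_deriv a b y)" and Yy: "AE x in lebesgue_on {a<..<b}. Y x = y x"
    using W12_primitive[OF ab y] by blast
  have "AE x in lebesgue_on {a<..<b}. Y x = Z x" using Yy ae by eventually_elim simp
  from continuous_AE_eq[OF ab is_primitive_continuous[OF Y] c this]
  show ?thesis using W12_weak_deriv(1)[OF y] by (intro is_primitive_cong[OF Y]) (auto simp: L2_def)
qed

text \<open>The way back from primitives to Sobolev functions. By uniqueness of weak derivatives,
  the representative chosen by \<open>weak_deriv\<close> can be replaced by the explicit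
  \<open>g\<close>.\<close>

lemma primitive_AE_W12:
  assumes ab: "a \<le> b" and Y: "is_primitive a b Y g"
    and y: "y \<in> borel_measurable (lebesgue_on {a<..<b})"
    and ae: "AE x in lebesgue_on {a<..<b}. Y x = y x"
  shows "y \<in> W12 a b" "is_weak_deriv a b y g" "AE x in lebesgue_on {a<..<b}. weak_deriv a b y x = g x"
proof -
  let ?M = "lebesgue_on {a<..<b}"
  have g: "g \<in> L2 {a<..<b}" using Y unfolding is_primitive_def by blast
  have YL: "Y \<in> L2 {a<..<b}" by (rule continuous_on_L2[OF is_primitive_continuous[OF Y]])
  have yL: "y \<in> L2 {a<..<b}" using L2m_cong_AE[OF YL[unfolded L2_eq_L2m] y ae] by (simp add: L2_eq_L2m)
  show wd: "is_weak_deriv a b y g"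
    unfolding is_weak_deriv_def
  proof
    fix \<phi> assume \<phi>: "\<phi> \<in> test_functions a b"
    note i = L2_test_integrable[OF _ continuous_on_test_function(2)[OF \<phi>]]
    have "(LINT x|?M. y x * complex_of_real (deriv \<phi> x)) = (LINT x|?M. Y x * complex_of_real (deriv \<phi> x))"
      by (rule integral_cong_AE)
        (use i[OF yL] i[OF YL] ae in \<open>auto intro: borel_measurable_integrable elim!: eventually_mono\<close>)
    also have "\<dots> = - (LINT x|?M. g x * complex_of_real (\<phi> x))"
      using is_primitive_weak_deriv[OF Y ab] \<phi> unfolding is_weak_deriv_def by blast
    finally show "(LINT x|?M. y x * complex_of_real (deriv \<phi> x)) = - (LINT x|?M. g x * complex_of_real (\<phi> x))" .
  qed
  show W: "y \<in> W12 a b" using yL g wd by (auto simp: W12_def)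
  show "AE x in ?M. weak_deriv a b y x = g x"
    by (rule weak_deriv_unique[OF W12_weak_deriv(1)[OF W] g W12_weak_deriv(2)[OF W] wd])
qed

text \<open>Passing to the continuous representative reduces this to the quotient of primitives. It
  also serves as the product rule, since dividing by \<open>1 / f\<close> multiplies by
  \<open>f\<close>.\<close>

lemma W12_divide:
  assumes ab: "a < b" and y: "y \<in> W12 a b" and f: "f \<in> W12 a b" and fc: "continuous_on {a..b} f"
    and nz: "\<And>x. x \<in> {a..b} \<Longrightarrow> f x \<noteq> 0"
  shows "(\<lambda>x. y x / f x) \<in> W12 a b"
proof -
  obtain Y where Y: "is_primitive a b Y (weak_deriv a b y)" and Yy: "AE x in lebesgue_on {a<..<b}. Y x = y x"
    using W12_primitive[OF ab y] by blast
  have F: "is_primitive a b f (weak_deriv a b f)" by (rule W12_continuous_primitive[OF ab f fc]) simp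
  obtain h where "is_primitive a b (\<lambda>x. Y x / f x) h" using is_primitive_quotient[OF Y F nz] by blast
  moreover have "AE x in lebesgue_on {a<..<b}. Y x / f x = y x / f x" using Yy by eventually_elim simp
  ultimately show ?thesis using ab W12_measurable[OF y] W12_measurable[OF f]
    by (intro primitive_AE_W12(1)[of a b "\<lambda>x. Y x / f x" h]) auto
qed

lemma W12_const: "a < b \<Longrightarrow> (\<lambda>x. c) \<in> W12 a b"
  by (rule primitive_AE_W12(1)[of a b "\<lambda>x. c" "\<lambda>x. 0"])
    (auto simp: is_primitive_def L2_def)

section \<open>The solutions for a coefficient and its reciprocal\<close>

text \<open>With \<open>I\<close> the integral of \<open>m\<close>, the function
  \<open>exp (- C * t) * I t\<close> starts at zero and has a nonpositive derivative, so
  \<open>I\<close> is nonpositive, and then so is \<open>m\<close>.\<close>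

lemma Gronwall_zero:
  fixes m :: "real \<Rightarrow> real"
  assumes m: "continuous_on {a..b} m" and m0: "\<And>x. x \<in> {a..b} \<Longrightarrow> 0 \<le> m x"
    and le: "\<And>x. x \<in> {a..b} \<Longrightarrow> m x \<le> C * integral {a..x} m" and C: "0 \<le> C"
    and x: "x \<in> {a..b}"
  shows "m x = 0"
proof -
  define I where "I x = integral {a..x} m" for x
  have dI: "(I has_vector_derivative m t) (at t within {a..x})" if "t \<in> {a..x}" for t
    unfolding I_def using that x
    by (intro integral_has_vector_derivative continuous_on_subset[OF m]) auto
  have "((\<lambda>t. exp (- C * t) * (m t - C * I t)) has_integral (exp (- C * x) * I x - exp (- C * a) * I a)) {a..x}"
  proof (rule fundamental_theorem_of_calculus)
    fix t assume t: "t \<in> {a..x}"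
    have "((\<lambda>t. exp (- C * t)) has_vector_derivative exp (- C * t) * (- C)) (at t within {a..x})"
      by (auto intro!: derivative_eq_intros simp: has_real_derivative_iff_has_vector_derivative[symmetric])
    from has_vector_derivative_mult[OF this dI[OF t]]
    show "((\<lambda>t. exp (- C * t) * I t) has_vector_derivative exp (- C * t) * (m t - C * I t)) (at t within {a..x})"
      by (simp add: algebra_simps)
  qed (use x in simp)
  moreover have "((\<lambda>t. 0::real) has_integral 0) {a..x}" by simp
  ultimately have "exp (- C * x) * I x - exp (- C * a) * I a \<le> 0"
  proof (rule has_integral_le)
    fix t assume "t \<in> {a..x}"
    then have "m t \<le> C * I t" using le[of t] x by (auto simp: I_def)
    then show "exp (- C * t) * (m t - C * I t) \<le> 0" by (simp add: mult_nonneg_nonpos)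
  qed
  moreover have "I a = 0" by (simp add: I_def)
  ultimately have "I x \<le> 0" by (simp add: mult_le_0_iff)
  then have "C * I x \<le> 0" using C by (simp add: mult_nonneg_nonpos)
  then show ?thesis using le[OF x] m0[OF x] by (simp add: I_def)
qed

text \<open>Adding the estimates for both equations gives an integral inequality for
  \<open>cmod (A x) + cmod (B x)\<close>. It is used with \<open>p = 1 / f\<close> and
  \<open>q = f\<close>.\<close>

lemma coupled_Volterra_zero:
  fixes A B p q :: "real \<Rightarrow> complex"
  assumes A: "continuous_on {a..b} A" and B: "continuous_on {a..b} B"
    and p: "continuous_on {a..b} p" and q: "continuous_on {a..b} q"
    and eA: "\<And>x. x \<in> {a..b} \<Longrightarrow> A x = \<kappa> * p x * integral {a..x} (\<lambda>t. q t * B t)"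
    and eB: "\<And>x. x \<in> {a..b} \<Longrightarrow> B x = \<kappa> * q x * integral {a..x} (\<lambda>t. p t * A t)"
    and x: "x \<in> {a..b}"
  shows "A x = 0"
proof -
  obtain P where P: "\<And>x. x \<in> {a..b} \<Longrightarrow> cmod (p x) \<le> P"
    using bounded_image_continuous[OF p] unfolding bounded_iff by (meson imageI)
  obtain Q where Q: "\<And>x. x \<in> {a..b} \<Longrightarrow> cmod (q x) \<le> Q"
    using bounded_image_continuous[OF q] unfolding bounded_iff by (meson imageI)
  have P0: "0 \<le> P" and Q0: "0 \<le> Q"
    using P[OF x] Q[OF x] norm_ge_zero order_trans by blast+
  define C where "C = cmod \<kappa> * P * Q"
  have C0: "0 \<le> C" using P0 Q0 by (simp add: C_def)
  \<comment> \<open>One estimate for both equations: \<open>u\<close> and \<open>v\<close> stand for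
    \<open>p\<close> and \<open>q\<close> in either order, and only the product of their bounds
    enters \<open>C\<close>.\<close>
  have bound: "cmod (\<kappa> * u y * integral {a..y} (\<lambda>t. v t * w t)) \<le> C * integral {a..y} (\<lambda>t. cmod (w t))"
    if y: "y \<in> {a..b}" and u: "cmod (u y) \<le> U" and v: "\<And>t. t \<in> {a..b} \<Longrightarrow> cmod (v t) \<le> V"
      and UV: "U * V = P * Q" "0 \<le> U" "0 \<le> V"
      and vc: "continuous_on {a..b} v" and wc: "continuous_on {a..b} w" for u v w y U V
  proof -
    have sub: "{a..y} \<subseteq> {a..b}" using y by auto
    have i: "(\<lambda>t. V * cmod (w t)) integrable_on {a..y}" "(\<lambda>t. v t * w t) integrable_on {a..y}"
      by (intro integrable_continuous_real continuous_intros continuous_on_subset[OF vc sub]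
          continuous_on_subset[OF wc sub])+
    have "cmod (integral {a..y} (\<lambda>t. v t * w t)) \<le> integral {a..y} (\<lambda>t. V * cmod (w t))"
      using i v sub by (intro integral_norm_bound_integral) (auto simp: norm_mult intro!: mult_right_mono)
    then have "cmod (\<kappa> * u y * integral {a..y} (\<lambda>t. v t * w t)) \<le> cmod \<kappa> * U * (V * integral {a..y} (\<lambda>t. cmod (w t)))"
      unfolding norm_mult using u UV by (intro mult_mono) auto
    also have "\<dots> = C * integral {a..y} (\<lambda>t. cmod (w t))" using UV(1) by (simp add: C_def)
    finally show ?thesis .
  qed
  define m where "m x = cmod (A x) + cmod (B x)" for x
  have mc: "continuous_on {a..b} m" unfolding m_def by (intro continuous_intros A B)
  have "m x = 0"
  proof (rule Gronwall_zero[OF mc _ _ C0 x])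
    show "0 \<le> m y" for y by (simp add: m_def)
    fix y assume y: "y \<in> {a..b}"
    have sub: "{a..y} \<subseteq> {a..b}" using y by auto
    have "cmod (A y) \<le> C * integral {a..y} (\<lambda>t. cmod (B t))"
      unfolding eA[OF y] by (rule bound[where U = P and V = Q]) (use y P Q P0 Q0 q B in auto)
    moreover have "cmod (B y) \<le> C * integral {a..y} (\<lambda>t. cmod (A t))"
      unfolding eB[OF y] by (rule bound[where U = Q and V = P]) (use y P Q P0 Q0 p A in auto)
    moreover have "integral {a..y} m = integral {a..y} (\<lambda>t. cmod (A t)) + integral {a..y} (\<lambda>t. cmod (B t))"
      unfolding m_def
      by (intro Henstock_Kurzweil_Integration.integral_add integrable_continuous_real continuous_intros
          continuous_on_subset[OF A sub] continuous_on_subset[OF B sub])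
    ultimately show "m y \<le> C * integral {a..y} m" by (simp add: m_def algebra_simps)
  qed
  then show ?thesis by (simp add: m_def add_nonneg_eq_0_iff)
qed

text \<open>Here \<open>U\<close> is the continuous representative of the quasi-derivative of
  \<open>e\<close>. The first identity integrates \<open>(e / f)' = U / f\<close>, the second
  integrates \<open>(f U)' = - \<rho>\<^sup>2 * f * e\<close>, which is the equation multiplied by
  \<open>f\<close>. The constants are the initial values, simplified by
  \<open>f 0 = 1\<close>.\<close>

lemma e_solution_system:
  assumes l: "0 < l" and f: "f \<in> W12 0 l" and fc: "continuous_on {0..l} f"
    and nz: "\<And>x. x \<in> {0..l} \<Longrightarrow> f x \<noteq> 0" and f0: "f 0 = 1"
    and e: "is_e_solution l f \<rho> e"
  shows "\<exists>U. continuous_on {0..l} U \<and>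
    (\<forall>x\<in>{0..l}. e x / f x = 1 + integral {0..x} (\<lambda>s. U s / f s)) \<and>
    (\<forall>x\<in>{0..l}. U x * f x = \<i> * \<rho> - \<rho>\<^sup>2 * integral {0..x} (\<lambda>s. f s * e s))"
proof -
  let ?M = "lebesgue_on {0<..<l}"
  define u where "u = Dop l f e"
  define w where "w = weak_deriv 0 l (\<lambda>s. e s / f s)"
  \<comment> \<open>Division by \<open>1 / f\<close> is the literal form that \<open>Dop\<close>
    takes for the reciprocal coefficient; it stands for the derivative of
    \<open>f * u\<close>.\<close>
  define v where "v = weak_deriv 0 l (\<lambda>s. u s / (1 / f s))"
  have eW: "e \<in> W12 0 l" and uW: "u \<in> W12 0 l" and ec: "continuous_on {0..l} e" and e0: "e 0 = 1"
    and eq: "AE x in ?M. schroedinger l f e x = \<rho>\<^sup>2 * e x" and u0: "cont_rep 0 l u 0 = \<i> * \<rho>"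
    using e by (auto simp: is_e_solution_def schroedinger_dom_def u_def)
  have uw: "u x = f x * w x" for x by (simp add: u_def w_def Dop_def)
  have fm: "f \<in> borel_measurable ?M" by (rule W12_measurable[OF f])
  have fiW: "(\<lambda>x. 1 / f x) \<in> W12 0 l" by (rule W12_divide[OF l W12_const[OF l] f fc nz])
  have fic: "continuous_on {0..l} (\<lambda>x. 1 / f x)" using nz by (intro continuous_intros fc) auto
  have efW: "(\<lambda>x. e x / f x) \<in> W12 0 l" by (rule W12_divide[OF l eW f fc nz])
  have ufW: "(\<lambda>x. u x / (1 / f x)) \<in> W12 0 l"
    by (rule W12_divide[OF l uW fiW fic]) (use nz in simp)
  define U where "U = cont_rep 0 l u"
  have "\<exists>W. continuous_on {0..l} W \<and> (AE x in ?M. W x = u x)"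
    using W12_primitive[OF l uW] is_primitive_continuous by blast
  from someI_ex[OF this] have Uc: "continuous_on {0..l} U" and Uu: "AE x in ?M. U x = u x"
    by (simp_all add: U_def cont_rep_def)
  have U0: "U 0 = \<i> * \<rho>" using u0 by (simp add: U_def)
  have efc: "continuous_on {0..l} (\<lambda>x. e x / f x)" using nz by (intro continuous_intros fc ec) auto
  have Ufc: "continuous_on {0..l} (\<lambda>x. U x * f x)" by (intro continuous_intros fc Uc)
  have nzAE: "AE x in ?M. f x \<noteq> 0" using nz by (intro AE_I2) auto
  have P1: "is_primitive 0 l (\<lambda>x. e x / f x) w"
    unfolding w_def by (rule W12_continuous_primitive[OF l efW efc]) simp
  have "is_primitive 0 l (\<lambda>x. e x / f x) (\<lambda>x. U x / f x)"
  proof (rule is_primitive_cong[OF P1 refl])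
    show "(\<lambda>x. U x / f x) \<in> borel_measurable ?M"
      by (intro borel_measurable_divide fm continuous_on_measurable_open continuous_on_subset[OF Uc]) auto
    show "AE x in ?M. w x = U x / f x" using Uu nzAE by eventually_elim (simp add: uw)
  qed
  then have 1: "\<forall>x\<in>{0..l}. e x / f x = e 0 / f 0 + integral {0..x} (\<lambda>s. U s / f s)"
    unfolding is_primitive_def by blast
  have P2: "is_primitive 0 l (\<lambda>x. U x * f x) v"
    unfolding v_def
    by (rule W12_continuous_primitive[OF l ufW Ufc]) (use Uu in eventually_elim, simp)
  have "is_primitive 0 l (\<lambda>x. U x * f x) (\<lambda>x. - \<rho>\<^sup>2 * (f x * e x))"
  proof (rule is_primitive_cong[OF P2 refl])
    show "(\<lambda>x. - \<rho>\<^sup>2 * (f x * e x)) \<in> borel_measurable ?M"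
      by (intro borel_measurable_times borel_measurable_const fm continuous_on_measurable_open
          continuous_on_subset[OF ec]) auto
    show "AE x in ?M. v x = - \<rho>\<^sup>2 * (f x * e x)" using eq nzAE
    proof eventually_elim
      case (elim x)
      have "schroedinger l f e x = - ((1 / f x) * v x)"
        by (simp add: schroedinger_def Dop_def[of l "\<lambda>s. 1 / f s"] v_def u_def)
      then show ?case using elim by (simp add: field_simps)
    qed
  qed
  then have 2: "\<forall>x\<in>{0..l}. U x * f x = U 0 * f 0 + integral {0..x} (\<lambda>s. - \<rho>\<^sup>2 * (f s * e s))"
    unfolding is_primitive_def by blast
  have "U x * f x = \<i> * \<rho> - \<rho>\<^sup>2 * integral {0..x} (\<lambda>s. f s * e s)" if x: "x \<in> {0..l}" for x
    using 2[rule_format, OF x] by (simp add: U0 f0)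
  then show ?thesis using Uc 1 e0 f0 by (intro exI[of _ U]) auto
qed

text \<open>The reciprocal coefficient interchanges the two first-order operators, so
  \<open>e'\<close> satisfies the system of \<open>e\<close> with \<open>f\<close> and
  \<open>1 / f\<close> exchanged. In the differences \<open>A\<close> and \<open>B\<close> the
  constants \<open>\<kappa>\<close> cancel, and the vanishing of \<open>A\<close> says
  \<open>U = \<i> * \<rho> * e'\<close>; this is then inserted into the integral formula for
  \<open>e / f\<close>.\<close>

lemma e_solution_relation:
  assumes l: "0 < l" and f: "f \<in> W12 0 l" and fc: "continuous_on {0..l} f"
    and nz: "\<And>x. x \<in> {0..l} \<Longrightarrow> f x \<noteq> 0" and f0: "f 0 = 1"
    and e: "is_e_solution l f \<rho> e" and e': "is_e_solution l (\<lambda>x. 1 / f x) \<rho> e'"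
    and x: "x \<in> {0..l}"
  shows "e x / f x = 1 + integral {0..x} (\<lambda>s. \<i> * \<rho> * e' s / f s)"
proof -
  define \<kappa> where "\<kappa> = \<i> * \<rho>"
  \<comment> \<open>In terms of \<open>\<kappa>\<close> the second-order term has the sign that lets
    \<open>\<kappa> * e\<close> and \<open>\<kappa> * e'\<close> be subtracted from \<open>V\<close>
    and \<open>U\<close>.\<close>
  have \<kappa>2: "\<rho>\<^sup>2 = - \<kappa> * \<kappa>" by (simp add: \<kappa>_def power2_eq_square algebra_simps)
  have fic: "continuous_on {0..l} (\<lambda>x. 1 / f x)" using nz by (intro continuous_intros fc) auto
  have fiW: "(\<lambda>x. 1 / f x) \<in> W12 0 l" by (rule W12_divide[OF l W12_const[OF l] f fc nz])
  have ec: "continuous_on {0..l} e" and ec': "continuous_on {0..l} e'"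
    using e e' by (simp_all add: is_e_solution_def)
  obtain U where Uc: "continuous_on {0..l} U"
    and U1: "\<And>x. x \<in> {0..l} \<Longrightarrow> e x / f x = 1 + integral {0..x} (\<lambda>s. U s / f s)"
    and U2: "\<And>x. x \<in> {0..l} \<Longrightarrow> U x * f x = \<kappa> + \<kappa> * \<kappa> * integral {0..x} (\<lambda>s. f s * e s)"
    using e_solution_system[OF l f fc nz f0 e] by (auto simp: \<kappa>2 \<kappa>_def[symmetric])
  obtain V where Vc: "continuous_on {0..l} V"
    and V1: "\<And>x. x \<in> {0..l} \<Longrightarrow> e' x * f x = 1 + integral {0..x} (\<lambda>s. V s * f s)"
    and V2: "\<And>x. x \<in> {0..l} \<Longrightarrow> V x / f x = \<kappa> + \<kappa> * \<kappa> * integral {0..x} (\<lambda>s. e' s / f s)"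
    using e_solution_system[OF l fiW fic _ _ e'] nz f0 by (auto simp: \<kappa>2 \<kappa>_def[symmetric])
  have int: "w integrable_on {0..y}" if "continuous_on {0..l} w" "y \<in> {0..l}" for w :: "real \<Rightarrow> complex" and y
    using that by (intro integrable_continuous_real continuous_on_subset[OF that(1)]) auto
  have cdiv: "continuous_on {0..l} (\<lambda>s. w s / f s)" if "continuous_on {0..l} w" for w
    using nz that by (intro continuous_intros fc) auto
  define A where "A x = U x - \<kappa> * e' x" for x
  define B where "B x = V x - \<kappa> * e x" for x
  have A0: "A y = 0" if y: "y \<in> {0..l}" for y
  proof (rule coupled_Volterra_zero[OF _ _ fic fc _ _ y])
    show "continuous_on {0..l} A" "continuous_on {0..l} B"
      unfolding A_def B_def by (intro continuous_intros Uc Vc ec ec')+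
    fix y assume y: "y \<in> {0..l}"
    have "integral {0..y} (\<lambda>s. f s * B s) = integral {0..y} (\<lambda>s. V s * f s - \<kappa> * (f s * e s))"
      by (simp add: B_def algebra_simps)
    also have "\<dots> = integral {0..y} (\<lambda>s. V s * f s) - integral {0..y} (\<lambda>s. \<kappa> * (f s * e s))"
      by (intro Henstock_Kurzweil_Integration.integral_diff int[OF _ y] continuous_intros fc Vc ec)
    also have "\<dots> = integral {0..y} (\<lambda>s. V s * f s) - \<kappa> * integral {0..y} (\<lambda>s. f s * e s)" by simp
    finally have I: "integral {0..y} (\<lambda>s. f s * B s)
      = integral {0..y} (\<lambda>s. V s * f s) - \<kappa> * integral {0..y} (\<lambda>s. f s * e s)" .
    have "A y * f y = U y * f y - \<kappa> * (e' y * f y)" by (simp add: A_def algebra_simps)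
    also have "\<dots> = - \<kappa> * integral {0..y} (\<lambda>s. f s * B s)"
      unfolding U2[OF y] V1[OF y] I by (simp add: algebra_simps)
    finally show "A y = (- \<kappa>) * (1 / f y) * integral {0..y} (\<lambda>s. f s * B s)"
      using nz[OF y] by (simp add: field_simps)
    have "integral {0..y} (\<lambda>s. 1 / f s * A s) = integral {0..y} (\<lambda>s. U s / f s - \<kappa> * (e' s / f s))"
      by (simp add: A_def diff_divide_distrib)
    also have "\<dots> = integral {0..y} (\<lambda>s. U s / f s) - integral {0..y} (\<lambda>s. \<kappa> * (e' s / f s))"
      by (intro Henstock_Kurzweil_Integration.integral_diff int[OF _ y] continuous_on_mult continuous_on_const cdiv Uc ec')
    also have "\<dots> = integral {0..y} (\<lambda>s. U s / f s) - \<kappa> * integral {0..y} (\<lambda>s. e' s / f s)"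
      by (simp only: Henstock_Kurzweil_Integration.integral_mult_right)
    finally have I: "integral {0..y} (\<lambda>s. 1 / f s * A s)
      = integral {0..y} (\<lambda>s. U s / f s) - \<kappa> * integral {0..y} (\<lambda>s. e' s / f s)" .
    have "B y / f y = V y / f y - \<kappa> * (e y / f y)" by (simp add: B_def diff_divide_distrib)
    also have "\<dots> = - \<kappa> * integral {0..y} (\<lambda>s. 1 / f s * A s)"
      unfolding U1[OF y] V2[OF y] I by (simp add: algebra_simps)
    finally show "B y = (- \<kappa>) * f y * integral {0..y} (\<lambda>s. 1 / f s * A s)"
      using nz[OF y] by (simp add: field_simps)
  qed
  have "integral {0..x} (\<lambda>s. U s / f s) = integral {0..x} (\<lambda>s. \<i> * \<rho> * e' s / f s)"
  proof (rule Henstock_Kurzweil_Integration.integral_cong)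
    fix s assume "s \<in> {0..x}"
    then have "A s = 0" using x by (intro A0) auto
    then show "U s / f s = \<i> * \<rho> * e' s / f s" by (simp add: A_def \<kappa>_def)
  qed
  then show ?thesis using U1[OF x] by simp
qed

section \<open>Transmutation operators\<close>

text \<open>The interval of integration is empty. The kernel equation covers only
  \<open>x > 0\<close>, so the left end point is settled separately.\<close>

lemma transmute_at_0: "transmute K y 0 = y 0"
proof -
  have "(LINT t|lebesgue_on {-0<..<0::real}. K 0 t * y t) = 0"
    by (rule integral_eq_zero_AE, rule AE_I2) simp
  then show ?thesis by (simp add: transmute_def)
qed

lemma transmute_expsum:
  assumes "x \<noteq> 0 \<Longrightarrow> K x \<in> L2 {-x<..<x}"
  shows "transmute K (expsum c n) x =
    (\<Sum>k\<le>n. c k * transmute K (\<lambda>t. exp (of_nat k * complex_of_real t)) x)"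
proof (cases "x = 0")
  case True
  then show ?thesis by (simp add: transmute_at_0 expsum_def)
next
  case False
  let ?M = "lebesgue_on {-x<..<x}" and ?E = "\<lambda>k t. exp (of_nat k * complex_of_real t)"
  have K: "K x \<in> L2m ?M" using assms False by (simp add: L2_eq_L2m)
  have i: "integrable ?M (\<lambda>t. K x t * ?E k t)" for k
    by (intro L2m_integrable_mult[OF K] continuous_on_L2[unfolded L2_eq_L2m] continuous_intros)
  have "(LINT t|?M. K x t * expsum c n t) = (LINT t|?M. (\<Sum>k\<le>n. c k * (K x t * ?E k t)))"
    by (simp add: expsum_def sum_distrib_left algebra_simps)
  also have "\<dots> = (\<Sum>k\<le>n. LINT t|?M. c k * (K x t * ?E k t))"
    using i by (intro Bochner_Integration.integral_sum) simp
  finally show ?thesis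
    by (simp add: transmute_def expsum_def sum.distrib[symmetric] algebra_simps)
qed

lemma kernel_L2:
  "is_transmutation_kernel l f K \<Longrightarrow> 0 < x \<Longrightarrow> x \<le> l \<Longrightarrow> K x \<in> L2 {-x<..<x}"
  by (simp add: is_transmutation_kernel_def)

text \<open>The choice \<open>\<rho> = - \<i> * k\<close> makes \<open>\<i> * \<rho>\<close> the
  natural number \<open>k\<close>. At \<open>x = 0\<close> the value is supplied by the initial
  condition of \<open>e\<close>.\<close>

lemma kernel_exp_solution:
  assumes K: "is_transmutation_kernel l f K"
  shows "\<exists>e. is_e_solution l f (- \<i> * of_nat k) e \<and>
    (\<forall>x\<in>{0..l}. transmute K (\<lambda>t. exp (of_nat k * complex_of_real t)) x = e x)"
proof -
  have r: "\<i> * (- \<i> * of_nat k) = of_nat k" by (simp add: algebra_simps)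
  obtain e where e: "is_e_solution l f (- \<i> * of_nat k) e"
    and ex: "\<And>x. x \<in> {0<..l} \<Longrightarrow> e x = exp (\<i> * (- \<i> * of_nat k) * complex_of_real x) +
      (LINT t|lebesgue_on {-x<..<x}. K x t * exp (\<i> * (- \<i> * of_nat k) * complex_of_real t))"
    using K unfolding is_transmutation_kernel_def by blast
  have "transmute K (\<lambda>t. exp (of_nat k * complex_of_real t)) x = e x" if "x \<in> {0..l}" for x
  proof (cases "x = 0")
    case True
    then show ?thesis using e by (simp add: transmute_at_0 is_e_solution_def)
  next
    case False
    then have "x \<in> {0<..l}" using that by simp
    from ex[OF this] show ?thesis unfolding r by (simp add: transmute_def)
  qed
  with e show ?thesis by blast
qed

text \<open>Continuity in \<open>x\<close> is inherited from the solutions \<open>e\<close>; it does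
  not come from the kernel, whose dependence on \<open>x\<close> is only square integrable.\<close>

lemma continuous_transmute_expsum:
  assumes K: "is_transmutation_kernel l f K"
  shows "continuous_on {0..l} (transmute K (expsum c n))"
proof -
  have "continuous_on {0..l} (transmute K (\<lambda>t. exp (of_nat k * complex_of_real t)))" for k
  proof -
    obtain e where "is_e_solution l f (- \<i> * of_nat k) e"
      and ex: "\<forall>x\<in>{0..l}. transmute K (\<lambda>t. exp (of_nat k * complex_of_real t)) x = e x"
      using kernel_exp_solution[OF K] by blast
    then have "continuous_on {0..l} e" by (simp add: is_e_solution_def)
    then show ?thesis by (rule continuous_on_eq) (simp add: ex)
  qed
  then have "continuous_on {0..l} (\<lambda>x. \<Sum>k\<le>n. c k * transmute K (\<lambda>t. exp (of_nat k * complex_of_real t)) x)"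
    by (intro continuous_intros)
  then show ?thesis
    by (rule continuous_on_eq) (rule transmute_expsum[symmetric], use kernel_L2[OF K] in auto)
qed

text \<open>For one exponential this is the relation between \<open>e\<close> and \<open>e'\<close>,
  with \<open>\<i> * \<rho> = k\<close>. The factor \<open>k\<close> is the one that differentiation
  puts on the coefficient, so linearity gives the identity for sums.\<close>

lemma transmute_expsum_relation:
  assumes l: "0 < l" and f: "f \<in> W12 0 l" and fc: "continuous_on {0..l} f"
    and nz: "\<And>x. x \<in> {0..l} \<Longrightarrow> f x \<noteq> 0" and f0: "f 0 = 1"
    and K: "is_transmutation_kernel l f K" and K': "is_transmutation_kernel l (\<lambda>x. 1 / f x) K'"
    and x: "x \<in> {0..l}"
  shows "transmute K (expsum c n) x / f x = expsum c n 0 +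
    integral {0..x} (\<lambda>s. transmute K' (expsum (\<lambda>k. of_nat k * c k) n) s / f s)"
proof -
  let ?E = "\<lambda>k t. exp (of_nat k * complex_of_real t)"
  have 1: "transmute K (?E k) x / f x = 1 + integral {0..x} (\<lambda>s. of_nat k * transmute K' (?E k) s / f s)"
    and i: "(\<lambda>s. of_nat k * transmute K' (?E k) s / f s) integrable_on {0..x}" for k
  proof -
    obtain e where e: "is_e_solution l f (- \<i> * of_nat k) e"
      and ex: "\<And>x. x\<in>{0..l} \<Longrightarrow> transmute K (?E k) x = e x"
      using kernel_exp_solution[OF K] by blast
    obtain e' where e': "is_e_solution l (\<lambda>x. 1 / f x) (- \<i> * of_nat k) e'"
      and ex': "\<And>x. x\<in>{0..l} \<Longrightarrow> transmute K' (?E k) x = e' x"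
      using kernel_exp_solution[OF K'] by blast
    have eq: "of_nat k * transmute K' (?E k) s / f s = \<i> * (- \<i> * of_nat k) * e' s / f s" if "s \<in> {0..x}" for s
      using ex'[of s] that x by simp
    show "transmute K (?E k) x / f x = 1 + integral {0..x} (\<lambda>s. of_nat k * transmute K' (?E k) s / f s)"
    proof -
      have "e x / f x = 1 + integral {0..x} (\<lambda>s. \<i> * (- \<i> * of_nat k) * e' s / f s)"
        using nz by (rule e_solution_relation[OF l f fc _ f0 e e' x])
      also have "integral {0..x} (\<lambda>s. \<i> * (- \<i> * of_nat k) * e' s / f s) =
          integral {0..x} (\<lambda>s. of_nat k * transmute K' (?E k) s / f s)"
        by (intro Henstock_Kurzweil_Integration.integral_cong eq[symmetric])
      finally show ?thesis by (simp only: ex[OF x])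
    qed
    have sub: "{0..x} \<subseteq> {0..l}" using x by simp
    have "continuous_on {0..x} (\<lambda>s. \<i> * (- \<i> * of_nat k) * e' s / f s)"
      using e' nz sub by (intro continuous_intros continuous_on_subset[OF _ sub] fc) (auto simp: is_e_solution_def)
    then have "continuous_on {0..x} (\<lambda>s. of_nat k * transmute K' (?E k) s / f s)"
      by (rule continuous_on_eq) (rule eq[symmetric])
    then show "(\<lambda>s. of_nat k * transmute K' (?E k) s / f s) integrable_on {0..x}"
      by (rule integrable_continuous_real)
  qed
  have "transmute K (expsum c n) x / f x = (\<Sum>k\<le>n. c k * (transmute K (?E k) x / f x))"
    using kernel_L2[OF K] x by (subst transmute_expsum) (auto simp: sum_divide_distrib)
  also have "\<dots> = (\<Sum>k\<le>n. c k + integral {0..x} (\<lambda>s. c k * (of_nat k * transmute K' (?E k) s / f s)))"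
    unfolding 1 by (simp only: Henstock_Kurzweil_Integration.integral_mult_right distrib_left mult_1_right)
  also have "\<dots> = (\<Sum>k\<le>n. c k) + (\<Sum>k\<le>n. integral {0..x} (\<lambda>s. c k * (of_nat k * transmute K' (?E k) s / f s)))"
    by (rule sum.distrib)
  also have "(\<Sum>k\<le>n. integral {0..x} (\<lambda>s. c k * (of_nat k * transmute K' (?E k) s / f s))) =
      integral {0..x} (\<lambda>s. \<Sum>k\<le>n. c k * (of_nat k * transmute K' (?E k) s / f s))"
    by (intro Henstock_Kurzweil_Integration.integral_sum[symmetric] integrable_on_mult_right i) simp
  also have "\<dots> = integral {0..x} (\<lambda>s. transmute K' (expsum (\<lambda>k. of_nat k * c k) n) s / f s)"
  proof (rule Henstock_Kurzweil_Integration.integral_cong)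
    fix s assume "s \<in> {0..x}"
    then show "(\<Sum>k\<le>n. c k * (of_nat k * transmute K' (?E k) s / f s)) =
        transmute K' (expsum (\<lambda>k. of_nat k * c k) n) s / f s"
      using kernel_L2[OF K'] x
      by (subst transmute_expsum) (auto simp: sum_divide_distrib algebra_simps intro!: sum.cong)
  qed
  also have "(\<Sum>k\<le>n. c k) = expsum c n 0" by (simp add: expsum_def)
  finally show ?thesis .
qed

section \<open>Integrability of kernel rows and passage to the limit\<close>

lemma triangle_lebesgue: "triangle l \<in> sets lebesgue"
proof -
  have "closed (triangle l)"
    unfolding triangle_def case_prod_beta
    by (intro closed_Collect_conj closed_Collect_le continuous_intros)
  then show ?thesis by (simp add: borel_closed)
qed

text \<open>The kernel is only Lebesgue measurable in the plane, while integration by rows is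
  available for the product of Borel measures. Its squared modulus is therefore replaced by a Borel
  function \<open>H'\<close> equal to it almost everywhere; for almost every \<open>x\<close> the
  two rows agree almost everywhere, and \<open>w\<close> is the row integral of
  \<open>H'\<close>.\<close>

lemma kernel_row_norm_bound:
  fixes K :: "real \<Rightarrow> real \<Rightarrow> complex"
  assumes KT: "(\<lambda>(x, t). K x t) \<in> L2 (triangle l)"
    and Kx: "\<And>x. x \<in> {0<..<l} \<Longrightarrow> K x \<in> L2 {-x<..<x}"
  shows "\<exists>w. integrable (lebesgue_on {0<..<l}) w \<and>
    (AE x in lebesgue_on {0<..<l}. (LINT t|lebesgue_on {-x<..<x}. (cmod (K x t))\<^sup>2) = w x)"
proof -
  define H where "H z = indicat_real (triangle l) z * (cmod (K (fst z) (snd z)))\<^sup>2" for z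
  have "set_integrable lebesgue (triangle l) (\<lambda>z. (cmod (K (fst z) (snd z)))\<^sup>2)"
    using KT triangle_lebesgue[of l]
    by (simp add: set_integrable_def integrable_restrict_space L2_def case_prod_beta)
  then have Hi: "integrable lebesgue H" by (simp add: set_integrable_def H_def[abs_def])
  obtain H' where H'm: "H' \<in> borel_measurable lborel" and HH': "AE z in lborel. H z = H' z"
    using completion_ex_borel_measurable_real[OF borel_measurable_integrable[OF Hi]] by blast
  have "integrable lebesgue H'"
    using Hi by (rule Bochner_Integration.integrable_cong_AE_imp)
      (use HH' H'm in \<open>auto intro: AE_completion measurable_completion elim!: eventually_mono\<close>)
  then have "integrable (lborel \<Otimes>\<^sub>M lborel) H'"
    using H'm by (simp add: integrable_completion lborel_prod)
  then have w0: "integrable lborel (\<lambda>x. LINT t|lborel. H' (x, t))"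
    by (rule lborel_pair.integrable_fst')
  define w where "w x = (LINT t|lborel. H' (x, t))" for x
  have "integrable lebesgue w"
    using w0 unfolding w_def[abs_def] by (subst integrable_completion) auto
  then have "set_integrable lebesgue {0<..<l} w"
    unfolding set_integrable_def by (intro integrable_mult_indicator) auto
  then have wi: "integrable (lebesgue_on {0<..<l}) w"
    by (simp add: set_integrable_def integrable_restrict_space)
  have "AE z in lborel \<Otimes>\<^sub>M lborel. H z = H' z"
    using HH' unfolding lborel_prod[symmetric] .
  then have "AE x in lborel. AE t in lborel. H (x, t) = H' (x, t)"
    by (rule lborel_pair.AE_pair)
  then have "AE x in lebesgue. AE t in lborel. H (x, t) = H' (x, t)" by (rule AE_completion)
  then have "AE x in lebesgue. x \<in> {0<..<l} \<longrightarrow> (LINT t|lebesgue_on {-x<..<x}. (cmod (K x t))\<^sup>2) = w x"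
  proof eventually_elim
    case (elim x)
    show ?case
    proof
      assume x: "x \<in> {0<..<l}"
      have m1: "(\<lambda>t. H' (x, t)) \<in> borel_measurable lborel"
        using H'm by (simp add: lborel_prod[symmetric])
      have "(LINT t|lebesgue_on {-x<..<x}. (cmod (K x t))\<^sup>2) =
          (LINT t|lebesgue. indicat_real {-x<..<x} t *\<^sub>R (cmod (K x t))\<^sup>2)"
        by (rule integral_restrict_space) simp
      also have "\<dots> = (LINT t|lebesgue. H' (x, t))"
      proof (rule integral_cong_AE)
        have "(\<lambda>t. (cmod (K x t))\<^sup>2) \<in> borel_measurable (lebesgue_on {-x<..<x})"
          using Kx[OF x] by (intro borel_measurable_integrable) (simp add: L2_def)
        then show "(\<lambda>t. indicat_real {-x<..<x} t *\<^sub>R (cmod (K x t))\<^sup>2) \<in> borel_measurable lebesgue"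
          by (simp add: borel_measurable_restrict_space_iff)
        show "(\<lambda>t. H' (x, t)) \<in> borel_measurable lebesgue" using m1 by (rule measurable_completion)
        \<comment> \<open>The row of the triangle is the closed interval, the row integral runs over
          the open one; the two end points are discarded as a null set.\<close>
        have "AE t in lebesgue. t \<notin> {x, -x}"
          by (rule AE_not_in) (simp add: negligible_iff_null_sets[symmetric])
        then show "AE t in lebesgue. indicat_real {-x<..<x} t *\<^sub>R (cmod (K x t))\<^sup>2 = H' (x, t)"
          using AE_completion[OF elim]
        proof eventually_elim
          case (elim t)
          then have "t \<in> {-x<..<x} \<longleftrightarrow> (x, t) \<in> triangle l"
            using x by (auto simp: triangle_def)
          then have "indicat_real {-x<..<x} t = indicat_real (triangle l) (x, t)"
            by (simp add: indicator_def)
          then show ?case using elim(2) by (simp add: H_def)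
        qed
      qed
      also have "\<dots> = w x" unfolding w_def by (rule integral_completion[OF m1])
      finally show "(LINT t|lebesgue_on {-x<..<x}. (cmod (K x t))\<^sup>2) = w x" .
    qed
  qed
  then have "AE x in lebesgue_on {0<..<l}. (LINT t|lebesgue_on {-x<..<x}. (cmod (K x t))\<^sup>2) = w x"
    by (subst AE_restrict_space_iff) auto
  with wi show ?thesis by blast
qed

lemma L2_limit_subinterval:
  fixes g :: "real \<Rightarrow> complex"
  assumes g: "g \<in> L2 {a<..<b}" and gn: "\<And>n. gn n \<in> L2 {a<..<b}" and "a \<le> c" "d \<le> b"
    and lim: "(\<lambda>n. LINT t|lebesgue_on {a<..<b}. (cmod (gn n t - g t))\<^sup>2) \<longlonglongrightarrow> 0"
  shows "(\<lambda>n. LINT t|lebesgue_on {c<..<d}. (cmod (gn n t - g t))\<^sup>2) \<longlonglongrightarrow> 0"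
proof (rule tendsto_sandwich[OF _ _ tendsto_const lim])
  have "(\<lambda>t. gn n t - g t) \<in> L2 {a<..<b}" for n using g gn by (simp add: L2_eq_L2m L2m_diff)
  then show "\<forall>\<^sub>F n in sequentially. (LINT t|lebesgue_on {c<..<d}. (cmod (gn n t - g t))\<^sup>2)
      \<le> (LINT t|lebesgue_on {a<..<b}. (cmod (gn n t - g t))\<^sup>2)"
    by (intro always_eventually allI L2_sq_integral_mono assms)
qed (intro always_eventually allI, simp)

text \<open>At a fixed \<open>x\<close> the summand \<open>y x\<close> needs pointwise convergence;
  the integral needs convergence in the mean against a single kernel row. Uniform convergence gives
  both.\<close>

lemma transmute_tendsto_uniform:
  assumes Kx: "K x \<in> L2 {-x<..<x}" and x: "0 < x" "x \<le> l"
    and u: "uniform_limit {-l..l} yn y sequentially"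
    and y: "continuous_on {-l..l} y" and yn: "\<And>n. continuous_on {-l..l} (yn n)"
  shows "(\<lambda>n. transmute K (yn n) x) \<longlonglongrightarrow> transmute K y x"
proof -
  have sub: "{-x..x} \<subseteq> {-l..l}" using x by auto
  have L: "y \<in> L2 {-x<..<x}" "yn n \<in> L2 {-x<..<x}" for n
    by (intro continuous_on_L2 continuous_on_subset[OF y sub] continuous_on_subset[OF yn sub])+
  have "uniform_limit {-x..x} yn y sequentially" by (rule uniform_limit_on_subset[OF u sub])
  from uniform_limit_L2[OF this L]
  have "(\<lambda>n. LINT t|lebesgue_on {-x<..<x}. K x t * yn n t) \<longlonglongrightarrow> (LINT t|lebesgue_on {-x<..<x}. K x t * y t)"
    using Kx L by (intro L2m_weak_limit) (simp_all add: L2_eq_L2m)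
  moreover have "(\<lambda>n. yn n x) \<longlonglongrightarrow> y x" using x by (intro tendsto_uniform_limitI[OF u]) simp
  ultimately show ?thesis unfolding transmute_def by (intro tendsto_add)
qed

text \<open>Cauchy-Schwarz in each row bounds the squared error of the integral part at
  \<open>x\<close> by the squared norm of \<open>K x\<close> times the squared error of
  \<open>gn n\<close>. The first factor is integrable in \<open>x\<close>, so the error tends to
  zero in the mean.\<close>

lemma transmute_L2_limit:
  assumes l: "0 < l"
    and KT: "(\<lambda>(x, t). K x t) \<in> L2 (triangle l)"
    and Kx: "\<And>x. x \<in> {0<..<l} \<Longrightarrow> K x \<in> L2 {-x<..<x}"
    and g: "g \<in> L2 {-l<..<l}" and gn: "\<And>n. gn n \<in> L2 {-l<..<l}"
    and lim: "(\<lambda>n. LINT t|lebesgue_on {-l<..<l}. (cmod (gn n t - g t))\<^sup>2) \<longlonglongrightarrow> 0"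
    and Tn: "\<And>n. transmute K (gn n) \<in> L2 {0<..<l}"
  shows "transmute K g \<in> L2 {0<..<l}"
    "(\<lambda>n. LINT x|lebesgue_on {0<..<l}. (cmod (transmute K (gn n) x - transmute K g x))\<^sup>2) \<longlonglongrightarrow> 0"
proof -
  let ?M = "lebesgue_on {0<..<l}" and ?N = "lebesgue_on {-l<..<l}"
  define J where "J y x = (LINT t|lebesgue_on {-x<..<x}. K x t * y t)" for y :: "real \<Rightarrow> complex" and x
  have T: "transmute K y x = y x + J y x" for y x by (simp add: transmute_def J_def)
  have g0: "g \<in> L2m ?M" and gn0: "gn n \<in> L2m ?M" for n
    using L2_subinterval[OF g, of 0 l] L2_subinterval[OF gn, of 0 l] l by (simp_all add: L2_eq_L2m)
  have sub: "h \<in> L2m (lebesgue_on {-x<..<x})" if "h \<in> L2 {-l<..<l}" "x \<in> {0<..<l}" for h x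
    using L2_subinterval[OF that(1), of "-x" x] that(2) by (simp add: L2_eq_L2m)
  have Jn: "J (gn n) \<in> L2m ?M" for n
    using L2m_diff[OF Tn[of n, unfolded L2_eq_L2m] gn0[of n]] by (simp add: T)
  have Jlim: "(\<lambda>n. J (gn n) x) \<longlonglongrightarrow> J g x" if x: "x \<in> {0<..<l}" for x
    unfolding J_def
  proof (rule L2m_weak_limit)
    show "(\<lambda>n. LINT t|lebesgue_on {-x<..<x}. (cmod (gn n t - g t))\<^sup>2) \<longlonglongrightarrow> 0"
      using x by (intro L2_limit_subinterval[OF g gn _ _ lim]) auto
  qed (use Kx[OF x] sub[OF g x] sub[OF gn x] in \<open>simp_all add: L2_eq_L2m\<close>)
  \<comment> \<open>Measurability in \<open>x\<close> is not visible from the integral; it is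
    inherited through pointwise limits from the approximants.\<close>
  have Jm: "J g \<in> borel_measurable ?M"
    by (rule borel_measurable_LIMSEQ_metric[of "\<lambda>n. J (gn n)"]) (use Jn Jlim in \<open>auto intro: L2m_measurable\<close>)
  obtain w where wi: "integrable ?M w"
    and w: "AE x in ?M. (LINT t|lebesgue_on {-x<..<x}. (cmod (K x t))\<^sup>2) = w x"
    using kernel_row_norm_bound[OF KT Kx] by blast
  define D where "D n = (LINT t|?N. (cmod (gn n t - g t))\<^sup>2)" for n
  have bound: "AE x in ?M. (cmod (J (gn n) x - J g x))\<^sup>2 \<le> w x * D n" for n
  proof -
    have "(cmod (J (gn n) x - J g x))\<^sup>2 \<le> (LINT t|lebesgue_on {-x<..<x}. (cmod (K x t))\<^sup>2) * D n"
      if x: "x \<in> {0<..<l}" for x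
    proof -
      let ?X = "lebesgue_on {-x<..<x}"
      have K2: "K x \<in> L2m ?X" using Kx[OF x] by (simp add: L2_eq_L2m)
      have d: "(\<lambda>t. gn n t - g t) \<in> L2 {-l<..<l}" using g gn by (simp add: L2_eq_L2m L2m_diff)
      have "J (gn n) x - J g x = (LINT t|?X. K x t * gn n t - K x t * g t)"
        unfolding J_def
        by (intro Bochner_Integration.integral_diff[symmetric] L2m_integrable_mult[OF K2] sub[OF g x] sub[OF gn x])
      also have "\<dots> = (LINT t|?X. K x t * (gn n t - g t))" by (simp add: algebra_simps)
      finally have "cmod (J (gn n) x - J g x) \<le> sqrt (LINT t|?X. (cmod (K x t))\<^sup>2) * sqrt (LINT t|?X. (cmod (gn n t - g t))\<^sup>2)"
        using L2m_norm_integral_mult_le[OF K2 sub[OF d x]] by simp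
      also have "\<dots> \<le> sqrt (LINT t|?X. (cmod (K x t))\<^sup>2) * sqrt (D n)"
        unfolding D_def using x by (intro mult_left_mono real_sqrt_le_mono L2_sq_integral_mono[OF d]) auto
      finally have "(cmod (J (gn n) x - J g x))\<^sup>2 \<le> (sqrt (LINT t|?X. (cmod (K x t))\<^sup>2) * sqrt (D n))\<^sup>2"
        by (rule power_mono) simp
      also have "\<dots> = (LINT t|?X. (cmod (K x t))\<^sup>2) * D n"
        by (simp add: power_mult_distrib D_def)
      finally show ?thesis .
    qed
    then have "AE x in ?M. (cmod (J (gn n) x - J g x))\<^sup>2 \<le> (LINT t|lebesgue_on {-x<..<x}. (cmod (K x t))\<^sup>2) * D n"
      by (intro AE_I2) simp
    then show ?thesis using w by eventually_elim simp
  qed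
  have Jd: "(\<lambda>x. J (gn n) x - J g x) \<in> L2m ?M" for n
    by (rule L2m_bound[OF _ _ bound]) (use Jm L2m_measurable[OF Jn] wi in auto)
  \<comment> \<open>\<open>J g\<close> is recovered as the difference of two square integrable
    functions, with any one approximant as reference.\<close>
  have "(\<lambda>x. J (gn 0) x - (J (gn 0) x - J g x)) \<in> L2m ?M" by (rule L2m_diff[OF Jn Jd])
  then have Jg: "J g \<in> L2m ?M" by simp
  show "transmute K g \<in> L2 {0<..<l}"
    using L2m_add[OF g0 Jg] by (simp add: L2_eq_L2m T[abs_def])
  have le: "(LINT x|?M. (cmod (transmute K (gn n) x - transmute K g x))\<^sup>2) \<le> 2 * D n + 2 * ((LINT x|?M. w x) * D n)" for n
  proof -
    have dd: "(\<lambda>x. gn n x - g x) \<in> L2m ?M" by (rule L2m_diff[OF gn0 g0])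
    have eq: "transmute K (gn n) x - transmute K g x = (gn n x - g x) + (J (gn n) x - J g x)" for x
      by (simp add: T)
    have "(LINT x|?M. (cmod (transmute K (gn n) x - transmute K g x))\<^sup>2) \<le>
        (LINT x|?M. 2 * (cmod (gn n x - g x))\<^sup>2 + 2 * (w x * D n))"
    proof (rule integral_mono_AE)
      show "integrable ?M (\<lambda>x. (cmod (transmute K (gn n) x - transmute K g x))\<^sup>2)"
        unfolding eq by (intro L2m_integrable_sq L2m_add dd Jd)
      show "integrable ?M (\<lambda>x. 2 * (cmod (gn n x - g x))\<^sup>2 + 2 * (w x * D n))"
        using wi L2m_integrable_sq[OF dd] by auto
      show "AE x in ?M. (cmod (transmute K (gn n) x - transmute K g x))\<^sup>2 \<le>
          2 * (cmod (gn n x - g x))\<^sup>2 + 2 * (w x * D n)"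
        using bound[of n]
      proof eventually_elim
        case (elim x)
        then show ?case unfolding eq
          using sq_norm_add_le[of "gn n x - g x" "J (gn n) x - J g x"] by linarith
      qed
    qed
    also have "\<dots> = 2 * (LINT x|?M. (cmod (gn n x - g x))\<^sup>2) + 2 * ((LINT x|?M. w x) * D n)"
      using wi L2m_integrable_sq[OF dd] by simp
    also have "(LINT x|?M. (cmod (gn n x - g x))\<^sup>2) \<le> D n"
      unfolding D_def
      by (rule L2_sq_integral_mono) (use l g gn in \<open>simp_all add: L2_eq_L2m L2m_diff\<close>)
    finally show ?thesis by simp
  qed
  have "(\<lambda>n. 2 * D n + 2 * ((LINT x|?M. w x) * D n)) \<longlonglongrightarrow> 2 * 0 + 2 * ((LINT x|?M. w x) * 0)"
    using lim unfolding D_def by (intro tendsto_intros)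
  then have lim0: "(\<lambda>n. 2 * D n + 2 * ((LINT x|?M. w x) * D n)) \<longlonglongrightarrow> 0" by simp
  show "(\<lambda>n. LINT x|?M. (cmod (transmute K (gn n) x - transmute K g x))\<^sup>2) \<longlonglongrightarrow> 0"
    by (rule tendsto_sandwich[OF _ _ tendsto_const lim0]) (auto intro!: always_eventually le)
qed

text \<open>The two sides of the identity for sums converge in different senses: the left at each
  point, by uniform approximation of \<open>Y\<close>; the right as a pairing of
  \<open>1 / f\<close> with functions converging in the mean on the interval from \<open>0\<close>
  to \<open>x\<close>.\<close>

lemma transmute_primitive:
  assumes l: "0 < l" and f: "f \<in> W12 0 l" and fc: "continuous_on {0..l} f"
    and nz: "\<And>x. x \<in> {0..l} \<Longrightarrow> f x \<noteq> 0" and f0: "f 0 = 1"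
    and K: "is_transmutation_kernel l f K" and K': "is_transmutation_kernel l (\<lambda>x. 1 / f x) K'"
    and Y: "is_primitive (-l) l Y g"
  shows "is_primitive 0 l (\<lambda>x. transmute K Y x / f x) (\<lambda>x. transmute K' g x / f x)"
proof -
  let ?M = "lebesgue_on {0<..<l}"
  have g: "g \<in> L2 {-l<..<l}" using Y unfolding is_primitive_def by blast
  have Yc: "continuous_on {-l..l} Y" by (rule is_primitive_continuous[OF Y])
  have ll: "-l \<le> l" using l by simp
  obtain c where "\<exists>N. uniform_limit {-l..l} (\<lambda>n. expsum (c n) (N n)) Y sequentially \<and>
    (\<lambda>n. LINT t|lebesgue_on {-l<..<l}. (cmod (expsum (\<lambda>k. of_nat k * c n k) (N n) t - g t))\<^sup>2) \<longlonglongrightarrow> 0"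
    using is_primitive_approx[OF Y ll] by (rule exE)
  then obtain N where "uniform_limit {-l..l} (\<lambda>n. expsum (c n) (N n)) Y sequentially \<and>
    (\<lambda>n. LINT t|lebesgue_on {-l<..<l}. (cmod (expsum (\<lambda>k. of_nat k * c n k) (N n) t - g t))\<^sup>2) \<longlonglongrightarrow> 0"
    by (rule exE)
  then have ulim: "uniform_limit {-l..l} (\<lambda>n. expsum (c n) (N n)) Y sequentially"
    and glim: "(\<lambda>n. LINT t|lebesgue_on {-l<..<l}. (cmod (expsum (\<lambda>k. of_nat k * c n k) (N n) t - g t))\<^sup>2) \<longlonglongrightarrow> 0"
    by simp_all
  define gn where "gn n = expsum (\<lambda>k. of_nat k * c n k) (N n)" for n
  have gnL: "gn n \<in> L2 {-l<..<l}" for n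
    unfolding gn_def by (rule continuous_on_L2[OF continuous_on_expsum])
  have TnL: "transmute K' (gn n) \<in> L2 {0<..<l}" for n
    unfolding gn_def by (rule continuous_on_L2[OF continuous_transmute_expsum[OF K']])
  have KT: "(\<lambda>(x, t). K' x t) \<in> L2 (triangle l)" and Kx: "\<And>x. x \<in> {0<..<l} \<Longrightarrow> K' x \<in> L2 {-x<..<x}"
    using K' by (simp_all add: is_transmutation_kernel_def)
  note TL = transmute_L2_limit[OF l KT Kx g gnL glim[folded gn_def] TnL]
  have fic: "continuous_on {0..l} (\<lambda>x. 1 / f x)" using nz by (intro continuous_intros fc) auto
  have hL: "(\<lambda>x. transmute K' g x / f x) \<in> L2 {0<..<l}"
    using L2_mult_continuous[OF fic TL(1)] by simp
  have "transmute K Y x / f x = Y 0 + integral {0..x} (\<lambda>s. transmute K' g s / f s)" if x: "x \<in> {0..l}" for x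
  proof (cases "x = 0")
    case True
    then show ?thesis by (simp add: transmute_at_0 f0)
  next
    case False
    then have x0: "0 < x" "x \<le> l" using x by auto
    let ?X = "lebesgue_on {0<..<x}"
    have "continuous_on {0..x} (\<lambda>s. 1 / f s)" by (rule continuous_on_subset[OF fic]) (use x0 in auto)
    then have fiX: "(\<lambda>s. 1 / f s) \<in> L2m ?X" using continuous_on_L2 L2_eq_L2m by blast
    have TX: "transmute K' g \<in> L2m ?X" "transmute K' (gn n) \<in> L2m ?X" for n
      using L2_subinterval[OF TL(1), of 0 x] L2_subinterval[OF TnL, of 0 x] x0 by (simp_all add: L2_eq_L2m)
    have I: "integral {0..x} (\<lambda>s. h s / f s) = (LINT s|?X. 1 / f s * h s)" if "h \<in> L2m ?X" for h
      using lebesgue_on_open_eq_integral[OF L2m_integrable_mult[OF fiX that]] by simp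
    have "(\<lambda>n. LINT s|?X. 1 / f s * transmute K' (gn n) s) \<longlonglongrightarrow> (LINT s|?X. 1 / f s * transmute K' g s)"
      using x0 by (intro L2m_weak_limit[OF fiX TX] L2_limit_subinterval[OF TL(1) TnL _ _ TL(2)]) auto
    then have "(\<lambda>n. integral {0..x} (\<lambda>s. transmute K' (gn n) s / f s)) \<longlonglongrightarrow> integral {0..x} (\<lambda>s. transmute K' g s / f s)"
      by (simp only: I TX)
    moreover have "(\<lambda>n. expsum (c n) (N n) 0) \<longlonglongrightarrow> Y 0"
      using l by (intro tendsto_uniform_limitI[OF ulim]) simp
    ultimately have "(\<lambda>n. expsum (c n) (N n) 0 + integral {0..x} (\<lambda>s. transmute K' (gn n) s / f s))
        \<longlonglongrightarrow> Y 0 + integral {0..x} (\<lambda>s. transmute K' g s / f s)"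
      by (intro tendsto_add)
    moreover have "expsum (c n) (N n) 0 + integral {0..x} (\<lambda>s. transmute K' (gn n) s / f s) =
        transmute K (expsum (c n) (N n)) x / f x" for n
      unfolding gn_def using nz by (rule transmute_expsum_relation[OF l f fc _ f0 K K' x, symmetric])
    ultimately have "(\<lambda>n. transmute K (expsum (c n) (N n)) x / f x)
        \<longlonglongrightarrow> Y 0 + integral {0..x} (\<lambda>s. transmute K' g s / f s)"
      by simp
    moreover have "(\<lambda>n. transmute K (expsum (c n) (N n)) x / f x) \<longlonglongrightarrow> transmute K Y x / f x"
    proof (intro tendsto_divide tendsto_const nz x)
      show "(\<lambda>n. transmute K (expsum (c n) (N n)) x) \<longlonglongrightarrow> transmute K Y x"
        by (rule transmute_tendsto_uniform[where l = l])
          (use kernel_L2[OF K x0] x0 ulim Yc continuous_on_expsum in auto)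
    qed
    ultimately show ?thesis using LIMSEQ_unique by blast
  qed
  then show ?thesis using hL unfolding is_primitive_def by (simp add: transmute_at_0 f0)
qed

lemma W12_cong_AE:
  assumes ab: "a < b" and y: "y \<in> W12 a b" and z: "z \<in> borel_measurable (lebesgue_on {a<..<b})"
    and ae: "AE x in lebesgue_on {a<..<b}. y x = z x"
  shows "z \<in> W12 a b"
proof -
  obtain Y where Y: "is_primitive a b Y (weak_deriv a b y)" and Yy: "AE x in lebesgue_on {a<..<b}. Y x = y x"
    using W12_primitive[OF ab y] by blast
  have "AE x in lebesgue_on {a<..<b}. Y x = z x" using Yy ae by eventually_elim simp
  then show ?thesis using ab by (intro primitive_AE_W12(1)[OF _ Y z]) auto
qed

theorem theorem25:
  fixes l :: real
    and f :: "real \<Rightarrow> complex"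
    and K K_inv :: "real \<Rightarrow> real \<Rightarrow> complex"
  assumes "l > 0"
    and "f \<in> W12 0 l" and "continuous_on {0..l} f"
    and "\<forall>x \<in> {0..l}. f x \<noteq> 0" and "f 0 = 1"
    and "is_transmutation_kernel l f K"
    and "is_transmutation_kernel l (\<lambda>x. 1 / f x) K_inv"
  shows "transmute K ` W12 (-l) l \<subseteq> W12 0 l \<and>
    (\<forall>y \<in> W12 (-l) l. AE x in lebesgue_on {0<..<l}.
       Dop l f (transmute K y) x = transmute K_inv (weak_deriv (-l) l y) x)"
proof -
  let ?M = "lebesgue_on {0<..<l}"
  note l = assms(1) and f = assms(2) and fc = assms(3) and f0 = assms(5) and K = assms(6) and K' = assms(7)
  have nz: "f x \<noteq> 0" if "x \<in> {0..l}" for x using assms(4) that by blast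
  have fm: "f \<in> borel_measurable ?M" by (rule W12_measurable[OF f])
  have fic: "continuous_on {0..l} (\<lambda>x. 1 / f x)" using nz by (intro continuous_intros fc) auto
  have fiW: "(\<lambda>x. 1 / f x) \<in> W12 0 l" by (rule W12_divide[OF l W12_const[OF l] f fc nz])
  have main: "transmute K y \<in> W12 0 l \<and>
      (AE x in ?M. Dop l f (transmute K y) x = transmute K_inv (weak_deriv (-l) l y) x)"
    if y: "y \<in> W12 (-l) l" for y
  proof -
    have ll: "-l < l" using l by simp
    obtain Y where Y: "is_primitive (-l) l Y (weak_deriv (-l) l y)"
      and Yy: "AE x in lebesgue_on {-l<..<l}. Y x = y x"
      using W12_primitive[OF ll y] by blast
    define h where "h x = transmute K_inv (weak_deriv (-l) l y) x / f x" for x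
    have P: "is_primitive 0 l (\<lambda>x. transmute K Y x / f x) h"
      unfolding h_def by (rule transmute_primitive[OF l f fc nz f0 K K' Y])
    have Yc: "continuous_on {-l..l} Y" by (rule is_primitive_continuous[OF Y])
    have yL: "y \<in> L2 {-l<..<l}" using y by (simp add: W12_def)
    have ym: "y \<in> borel_measurable ?M" and Ym: "Y \<in> borel_measurable ?M"
      using L2_subinterval[OF yL, of 0 l] L2_subinterval[OF continuous_on_L2[OF Yc], of 0 l] l
      by (simp_all add: L2_def)
    have Yy0: "AE x in ?M. Y x = y x"
      using l by (intro AE_lebesgue_on_subset[OF Yy]) auto
    \<comment> \<open>\<open>y\<close> and its continuous representative \<open>Y\<close> may differ
      at points. The integral parts agree for every \<open>x\<close>, since they ignore null sets,
      so the two transforms differ exactly by \<open>y - Y\<close>.\<close>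
    have eq: "transmute K y x = y x + (transmute K Y x - Y x)" if x: "x \<in> {0<..<l}" for x
    proof -
      let ?X = "lebesgue_on {-x<..<x}"
      have "K x \<in> L2 {-x<..<x}" using x by (intro kernel_L2[OF K]) auto
      moreover have "y \<in> L2 {-x<..<x}" "Y \<in> L2 {-x<..<x}"
        using L2_subinterval[OF yL, of "-x" x] L2_subinterval[OF continuous_on_L2[OF Yc], of "-x" x] x by auto
      moreover have "AE t in ?X. Y t = y t" using x by (intro AE_lebesgue_on_subset[OF Yy]) auto
      ultimately have "(LINT t|?X. K x t * y t) = (LINT t|?X. K x t * Y t)"
        by (intro integral_cong_AE) (auto simp: L2_def elim!: eventually_mono)
      then show ?thesis by (simp add: transmute_def)
    qed
    \<comment> \<open>The quotient by \<open>f\<close> is a primitive and hence continuous;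
      multiplying by \<open>f\<close> returns the transform itself.\<close>
    have "transmute K Y \<in> borel_measurable ?M"
    proof -
      have "(\<lambda>x. transmute K Y x / f x) \<in> borel_measurable ?M"
        by (rule continuous_on_measurable_open, rule continuous_on_subset[OF is_primitive_continuous[OF P]]) auto
      from borel_measurable_times[OF this fm] show ?thesis
        by (rule measurable_cong[THEN iffD1, rotated]) (use nz in simp)
    qed
    then have "(\<lambda>x. y x + (transmute K Y x - Y x)) \<in> borel_measurable ?M"
      using ym Ym by (intro borel_measurable_add borel_measurable_diff)
    then have Tm: "transmute K y \<in> borel_measurable ?M"
      by (rule measurable_cong[THEN iffD1, rotated]) (simp add: eq)
    have TY: "AE x in ?M. transmute K Y x / f x = transmute K y x / f x"
      using Yy0 AE_space by eventually_elim (simp add: eq)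
    note Q = primitive_AE_W12[OF less_imp_le[OF l] P borel_measurable_divide[OF Tm fm] TY]
    \<comment> \<open>The quotient by \<open>f\<close> is already known to be in the Sobolev space,
      and dividing it by \<open>1 / f\<close> restores the transform.\<close>
    have "(\<lambda>x. transmute K y x / f x / (1 / f x)) \<in> W12 0 l"
      by (rule W12_divide[OF l Q(1) fiW fic]) (use nz in simp)
    then have "transmute K y \<in> W12 0 l"
      by (rule W12_cong_AE[OF l _ Tm]) (use nz in \<open>auto intro!: AE_I2\<close>)
    moreover have "AE x in ?M. Dop l f (transmute K y) x = transmute K_inv (weak_deriv (-l) l y) x"
      \<comment> \<open>The weak derivative of the quotient is \<open>h\<close> almost everywhere,
        and the factor \<open>f\<close> in \<open>Dop\<close> cancels the denominator of
        \<open>h\<close>.\<close>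
      using Q(3) AE_space by eventually_elim (use nz in \<open>simp add: Dop_def h_def\<close>)
    ultimately show ?thesis by blast
  qed
  then show ?thesis by blast
qed

end
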